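(* Let $d\ge1$, $T\ge1$, $K_t^j\subseteq\mathbb R$ closed, $K_t=\prod_{j=1}^dK_t^j$, $\Omega=K_0\times\dots\times K_T$. For $t=0,\dots,T$ let $\mathcal E_t\subseteq C_t$ be vector subspaces with $\mathcal E_t+\mathbb R=\mathcal E_t$ containing the coordinate maps $X_t$ ($x_t\mapsto x_t^j$), and let $S_t:\mathcal E_t\to\mathbb R$ be concave, cash additive ($S_t(\varphi_t+k)=S_t(\varphi_t)+k$, $k\in\mathbb R$) with $S_t(0)=0$. Set $\mathcal E=\mathcal E_0\times\dots\times\mathcal E_T$, $U(\varphi)=\sum_{t=0}^TS_t(\varphi_t)$, $V(\varphi)=-U(-\varphi)$, and suppose that for every $t$ there exist compact $\mathfrak K_t(n)\subseteq K_t$ and $0\le f_t^n\in\mathcal E_t$ ($n\ge1$) with $1+\sum_{t,j}|x_t^j|\le\sum_tf_t^n(x_t)$ for all $x\in\Omega\setminus(\mathfrak K_0(n)\times\dots\times\mathfrak K_T(n))$ and $V(\Gamma f_0^n,\dots,\Gamma f_T^n)\to0$ for every $\Gamma>0$. Let, for $Q_t\in\mathrm{Prob}^1(K_t)$, $\mathcal D_t(Q_t):=\sup_{\varphi_t\in\mathcal E_t}\big(S_t(\varphi_t)-\int_{K_t}\varphi_t\,dQ_t\big)$. Let $c:\Omega\to(-\infty,+\infty]$ be lower semicontinuous with $c(x)\ge-A(1+\sum_{t,j}|x_t^j|)$ for some $A\ge0$. Then $$\sup\Big\{\sum_{t=0}^TS_t(\varphi_t):\varphi\in\mathcal E,\ \exists\Delta\in\mathcal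 H\text{ with }\sum_{t=0}^T\varphi_t(x_t)+I^\Delta(x)\le c(x)\ \forall x\in\Omega\Big\}=\inf_{Q\in\mathrm{Mart}(\Omega)}\Big(E_Q[c]+\sum_{t=0}^T\mathcal D_t(Q_t)\Big),$$ and the infimum is a minimum provided the common value is $<+\infty$.
   Context: $C_t$ is the space of continuous $\phi:K_t\to\mathbb R$ with $\sup_{x_t}|\phi(x_t)|/(1+\sum_j|x_t^j|)<\infty$. $\mathrm{Prob}^1(K_t)$ (resp. $\mathrm{Prob}^1(\Omega)$): Borel probability measures integrating all $|x_t^j|$; $Q_t$ is the marginal of $Q$ on $K_t$. $\mathcal H$: $\Delta=(\Delta_0,\dots,\Delta_{T-1})$ with $\Delta_t\in(C_b(K_0\times\dots\times K_t))^d$; $I^\Delta(x)=\sum_{t=0}^{T-1}\sum_{j=1}^d\Delta_t^j(x_0,\dots,x_t)(x_{t+1}^j-x_t^j)$. $\mathrm{Mart}(\Omega)=\{Q\in\mathrm{Prob}^1(\Omega):E_Q[I^\Delta]=0\ \forall\Delta\in\mathcal H\}$. *)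

theory Defs
  imports "HOL-Probability.Probability"
begin

text \<open>Coordinates: R^d is real^'d for a finite index type 'd (so d = CARD('d) >= 1).
  Kc t j is the closed set K_t^j; a path x is a function nat => real^'d, extensional
  on {0..T}.\<close>

definition Kset :: "(nat \<Rightarrow> 'd::finite \<Rightarrow> real set) \<Rightarrow> nat \<Rightarrow> (real^'d) set" where
  "Kset Kc t = {y. \<forall>j. y $ j \<in> Kc t j}"

definition Omega :: "nat \<Rightarrow> (nat \<Rightarrow> 'd::finite \<Rightarrow> real set) \<Rightarrow> (nat \<Rightarrow> real^'d) set" where
  "Omega T Kc = PiE {0..T} (Kset Kc)"

text \<open>C_t: continuous functions on K_t with linear growth (values off K_t are irrelevant).\<close>
definition Ct :: "(nat \<Rightarrow> 'd::finite \<Rightarrow> real set) \<Rightarrow> nat \<Rightarrow> (real^'d \<Rightarrow> real) set" where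
  "Ct Kc t = {\<phi>. continuous_on (Kset Kc t) \<phi> \<and>
      (\<exists>C. \<forall>y\<in>Kset Kc t. \<bar>\<phi> y\<bar> \<le> C * (1 + (\<Sum>j\<in>UNIV. \<bar>y $ j\<bar>)))}"

definition Hstrat :: "nat \<Rightarrow> (nat \<Rightarrow> 'd::finite \<Rightarrow> real set)
    \<Rightarrow> (nat \<Rightarrow> (nat \<Rightarrow> real^'d) \<Rightarrow> real^'d) set" where
  "Hstrat T Kc = {\<Delta>. \<forall>t<T. continuous_on (PiE {0..t} (Kset Kc)) (\<Delta> t) \<and>
                        bounded (\<Delta> t ` PiE {0..t} (Kset Kc))}"

definition Idelta :: "nat \<Rightarrow> (nat \<Rightarrow> (nat \<Rightarrow> real^'d::finite) \<Rightarrow> real^'d)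
    \<Rightarrow> (nat \<Rightarrow> real^'d) \<Rightarrow> real" where
  "Idelta T \<Delta> x = (\<Sum>t<T. \<Sum>j\<in>UNIV.
       (\<Delta> t (restrict x {0..t})) $ j * (x (Suc t) $ j - x t $ j))"

definition path_space :: "nat \<Rightarrow> (nat \<Rightarrow> real^'d::finite) measure" where
  "path_space T = PiM {0..T} (\<lambda>_. borel)"

definition Prob1 :: "nat \<Rightarrow> (nat \<Rightarrow> 'd::finite \<Rightarrow> real set) \<Rightarrow> (nat \<Rightarrow> real^'d) measure set" where
  "Prob1 T Kc = {Q. sets Q = sets (path_space T) \<and> prob_space Q \<and>
      emeasure Q (Omega T Kc) = 1 \<and>
      (\<forall>t\<le>T. \<forall>j. integrable Q (\<lambda>x. \<bar>x t $ j\<bar>))}"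

definition Mart :: "nat \<Rightarrow> (nat \<Rightarrow> 'd::finite \<Rightarrow> real set) \<Rightarrow> (nat \<Rightarrow> real^'d) measure set" where
  "Mart T Kc = {Q \<in> Prob1 T Kc. \<forall>\<Delta>\<in>Hstrat T Kc. (LINT x:Omega T Kc|Q. Idelta T \<Delta> x) = 0}"

definition marg :: "(nat \<Rightarrow> real^'d::finite) measure \<Rightarrow> nat \<Rightarrow> (real^'d) measure" where
  "marg Q t = distr Q borel (\<lambda>x. x t)"

definition Dpen :: "(real^'d::finite) set \<Rightarrow> (real^'d \<Rightarrow> real) set \<Rightarrow> ((real^'d \<Rightarrow> real) \<Rightarrow> real)
    \<Rightarrow> (real^'d) measure \<Rightarrow> ereal" where
  "Dpen K E S Qt = (SUP \<phi>\<in>E. ereal (S \<phi> - (LINT y:K|Qt. \<phi> y)))"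

text \<open>E_Q[c] for c with values in (-inf,+inf] bounded below by an integrable function,
  integrated over Omega: positive part minus negative part.\<close>
definition ereal_expect :: "'a measure \<Rightarrow> 'a set \<Rightarrow> ('a \<Rightarrow> ereal) \<Rightarrow> ereal" where
  "ereal_expect Q A c =
     enn2ereal (\<integral>\<^sup>+ x. e2ennreal (if x \<in> A then c x else 0) \<partial>Q)
   - enn2ereal (\<integral>\<^sup>+ x. e2ennreal (- (if x \<in> A then c x else 0)) \<partial>Q)"

end

theory Submission
  imports Defs
begin

text \<open>Weak duality is integration of the constraint. For the converse, let \<open>r(x)\<close> be the primal value
  with \<open>c\<close> replaced by \<open>c + x\<close>, where \<open>x\<close> ranges over the space \<open>B\<close> of continuous functions of linear
  growth on the path space. If \<open>r(0)\<close> is finite then \<open>r\<close> is finite, concave, monotone and cash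
  additive on \<open>B\<close>, so Hahn--Banach gives a linear \<open>L\<close> with \<open>r(x) \<le> r(0) + L(x)\<close>; it is positive with
  \<open>L(1) = 1\<close>. The tightness condition makes \<open>L(\<Sum>\<^sub>t f\<^sub>t\<^sup>n)\<close> arbitrarily small, and with Dini's theorem this
  yields Daniell's continuity, so \<open>L\<close> is integration against a probability measure \<open>Q\<close>. Inserting
  \<open>x = \<Sum>\<^sub>t \<phi>\<^sub>t + I\<^sup>\<Delta> - g\<close> with \<open>g \<in> B\<close>, \<open>g \<le> c\<close> shows that \<open>Q\<close> is a martingale measure (scale \<open>\<Delta>\<close>) and, letting
  \<open>g\<close> increase to \<open>c\<close>, that \<open>Q\<close> attains the value \<open>r(0)\<close>.\<close>

section \<open>Linear minorants of convex functionals\<close>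

text \<open>The obstacle is that \<open>\<Omega>\<close> need not be compact and the payoffs are
  unbounded, so a positive functional on \<open>B\<close> could lose mass at infinity. Daniell's
  criterion settles both points at once: it yields a measure and the integrability of every function
  in \<open>B\<close>, hence first moments. The smallness of \<open>L (F n)\<close>, where
  \<open>F n\<close> sums the \<open>f t n\<close> over the dates, comes from two bounds on the
  value at the perturbation \<open>- \<Gamma> * F n\<close>. The supergradient inequality bounds it
  above by \<open>r(0) - \<Gamma> * L (F n)\<close>, and an explicit feasible \<open>\<phi>\<close>
  bounds it below by a constant that for large \<open>n\<close> does not depend on
  \<open>\<Gamma>\<close>; then \<open>\<Gamma>\<close> is taken large. Finiteness of
  \<open>r\<close> spreads from 0 to all of \<open>B\<close> by concavity, since 0 is the midpoint
  of \<open>x\<close> and \<open>-x\<close> and no feasible set is empty. The \<open>S t\<close> are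
  not assumed monotone: positivity of \<open>L\<close> comes from the feasible sets, which grow with
  \<open>x\<close>.\<close>

text \<open>A minimal convex minorant exists by Zorn's lemma; comparing it with its rescalings and with
  its directional modifications shows that minimality forces linearity.\<close>

definition cvx_fun :: "('a \<Rightarrow> real) set \<Rightarrow> (('a \<Rightarrow> real) \<Rightarrow> real) \<Rightarrow> bool" where
  "cvx_fun B F \<longleftrightarrow> (\<forall>x\<in>B. \<forall>y\<in>B. \<forall>l. 0 \<le> l \<longrightarrow> l \<le> 1 \<longrightarrow>
      F (\<lambda>z. l * x z + (1 - l) * y z) \<le> l * F x + (1 - l) * F y)"

text \<open>Averaging \<open>x\<close> and \<open>-x\<close> shows that every convex minorant
  vanishing at 0 lies above \<open>- q (-x)\<close>. Infima along chains are therefore finite, and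
  Zorn's lemma applies.\<close>

lemma ex_minimal_convex_minorant:
  fixes B :: "('a \<Rightarrow> real) set" and q :: "('a \<Rightarrow> real) \<Rightarrow> real"
  assumes ne: "B \<noteq> {}"
    and lin: "\<And>x y a b. x \<in> B \<Longrightarrow> y \<in> B \<Longrightarrow> (\<lambda>z. a * x z + b * y z) \<in> B"
    and q0: "q (\<lambda>z. 0) = 0"
    and qconv: "cvx_fun B q"
  shows "\<exists>F. F (\<lambda>z. 0) = 0 \<and> (\<forall>x\<in>B. F x \<le> q x) \<and> cvx_fun B F \<and>
    (\<forall>G. G (\<lambda>z. 0) = 0 \<longrightarrow> (\<forall>x\<in>B. G x \<le> F x) \<longrightarrow> cvx_fun B G \<longrightarrow> (\<forall>x\<in>B. G x = F x))"
proof -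
  \<comment> \<open>Setting candidates to 0 off \<open>B\<close> makes the pointwise order on all
    arguments the order on \<open>B\<close>. The relation \<open>P\<close> is the reversed order, so
    a maximal element is a minimal minorant.\<close>
  define A where "A = {F. (\<forall>x. x \<notin> B \<longrightarrow> F x = 0) \<and> F (\<lambda>z. 0) = 0 \<and> cvx_fun B F \<and> (\<forall>x\<in>B. F x \<le> q x)}"
  define P where "P F G \<longleftrightarrow> (\<forall>x. G x \<le> F x)" for F G :: "('a \<Rightarrow> real) \<Rightarrow> real"
  have B0: "(\<lambda>z. 0) \<in> B"
    using ne lin[of _ _ 0 0] by auto
  have lower: "- q (\<lambda>z. - x z) \<le> F x" if "F \<in> A" "x \<in> B" for F x
  proof -
    have m: "(\<lambda>z. - x z) \<in> B"
      using lin[OF that(2) that(2), of "-1" 0] by simp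
    have "F (\<lambda>z. (1/2) * x z + (1 - 1/2) * - x z) \<le> (1/2) * F x + (1 - 1/2) * F (\<lambda>z. - x z)"
    proof -
      have "cvx_fun B F" using that by (simp add: A_def)
      from this[unfolded cvx_fun_def, rule_format, OF that(2) m, of "1/2"] show ?thesis by simp
    qed
    moreover have "F (\<lambda>z. (1/2) * x z + (1 - 1/2) * - x z) = 0"
      using that unfolding A_def by simp
    moreover have "F (\<lambda>z. - x z) \<le> q (\<lambda>z. - x z)"
      using that m unfolding A_def by auto
    ultimately show ?thesis by simp
  qed
  have "\<exists>m\<in>A. \<forall>a\<in>A. P m a \<longrightarrow> a = m"
  proof (rule predicate_Zorn)
    show "partial_order_on A (relation_of P A)"
    proof (rule partial_order_on_relation_ofI)
      fix F G assume "P F G" "P G F"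
      then show "F = G" unfolding P_def by (intro ext antisym) auto
    next
      fix F G H assume "P F G" "P G H"
      then show "P F H" unfolding P_def by (meson order_trans)
    qed (simp add: P_def)
  next
    fix C assume C: "C \<in> Chains (relation_of P A)"
    have CA: "C \<subseteq> A" and tot: "\<And>F G. F \<in> C \<Longrightarrow> G \<in> C \<Longrightarrow> P F G \<or> P G F"
      using C unfolding Chains_def relation_of_def by auto
    show "\<exists>u\<in>A. \<forall>a\<in>C. P a u"
    proof (cases "C = {}")
      case True
      have "(\<lambda>x. if x \<in> B then q x else 0) \<in> A"
        using q0 qconv lin unfolding A_def cvx_fun_def by auto
      then show ?thesis using True by auto
    next
      case False
      define u where "u x = (if x \<in> B then (INF F\<in>C. F x) else 0)" for x
      have bdd: "bdd_below ((\<lambda>F. F x) ` C)" if "x \<in> B" for x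
        using lower[OF _ that] CA by (intro bdd_belowI2[where m="- q (\<lambda>z. - x z)"]) auto
      have u_le: "u x \<le> F x" if "F \<in> C" for x F
        using that bdd CA unfolding u_def by (auto intro!: cINF_lower simp: A_def)
      have u_ap: "\<exists>F\<in>C. F x < u x + e" if "x \<in> B" "e > 0" for x and e :: real
        using cINF_less_iff[OF False bdd[OF that(1)], of "u x + e"] that unfolding u_def by auto
      have "cvx_fun B u"
        unfolding cvx_fun_def
      proof (intro ballI allI impI)
        fix x y and l :: real assume xy: "x \<in> B" "y \<in> B" and l: "0 \<le> l" "l \<le> 1"
        show "u (\<lambda>z. l * x z + (1 - l) * y z) \<le> l * u x + (1 - l) * u y"
        proof (rule field_le_epsilon)
          fix e :: real assume "e > 0"
          obtain F where F: "F \<in> C" "F x < u x + e" using u_ap xy \<open>e > 0\<close> by blast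
          obtain G where G: "G \<in> C" "G y < u y + e" using u_ap xy \<open>e > 0\<close> by blast
          \<comment> \<open>Convexity survives the infimum because the chain is total: the smaller
            of the two near-minimisers serves at both points.\<close>
          obtain H where H: "H \<in> C" "H x \<le> F x" "H y \<le> G y"
            using tot[OF F(1) G(1)] F(1) G(1) unfolding P_def by blast
          have "u (\<lambda>z. l * x z + (1 - l) * y z) \<le> H (\<lambda>z. l * x z + (1 - l) * y z)"
            by (rule u_le[OF H(1)])
          also have "\<dots> \<le> l * H x + (1 - l) * H y"
            using H(1) CA xy l unfolding A_def cvx_fun_def by auto
          also have "\<dots> \<le> l * (u x + e) + (1 - l) * (u y + e)"
            using H F G l by (intro add_mono mult_left_mono) auto
          also have "\<dots> = l * u x + (1 - l) * u y + e" by (simp add: algebra_simps)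
          finally show "u (\<lambda>z. l * x z + (1 - l) * y z) \<le> l * u x + (1 - l) * u y + e" .
        qed
      qed
      moreover have "u (\<lambda>z. 0) = 0"
      proof -
        have "(\<lambda>F. F (\<lambda>z. 0)) ` C = {0::real}"
          using CA False unfolding A_def by auto
        then show ?thesis using B0 unfolding u_def by simp
      qed
      moreover have "u x \<le> q x" if "x \<in> B" for x
      proof -
        obtain F where F: "F \<in> C" using False by blast
        then have "F x \<le> q x" using CA that unfolding A_def by auto
        then show ?thesis using u_le[OF F, of x] by linarith
      qed
      ultimately have "u \<in> A" unfolding A_def by (auto simp: u_def)
      then show ?thesis using u_le unfolding P_def by auto
    qed
  qed
  then obtain F where F: "F \<in> A" and min: "\<And>G. G \<in> A \<Longrightarrow> P F G \<Longrightarrow> G = F" by blast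
  have F': "F (\<lambda>z. 0) = 0" "cvx_fun B F" "\<And>x. x \<in> B \<Longrightarrow> F x \<le> q x"
    using F by (simp_all add: A_def)
  have min': "\<forall>x\<in>B. G x = F x"
    if G: "G (\<lambda>z. 0) = 0" "\<forall>x\<in>B. G x \<le> F x" "cvx_fun B G" for G
  proof -
    define G' where "G' x = (if x \<in> B then G x else 0)" for x
    have "G x \<le> q x" if "x \<in> B" for x
      using G(2) F'(3)[OF that] that by force
    then have "G' \<in> A"
      using G(1,3) lin unfolding A_def G'_def cvx_fun_def by auto
    moreover have "P F G'" using G F unfolding P_def G'_def A_def by auto
    ultimately have "G' = F" by (rule min)
    show ?thesis
    proof
      fix x assume "x \<in> B"
      then show "G x = F x" using fun_cong[OF \<open>G' = F\<close>, of x] by (simp add: G'_def)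
    qed
  qed
  show ?thesis
  proof (intro exI[of _ F] conjI)
    show "\<forall>G. G (\<lambda>z. 0) = 0 \<longrightarrow> (\<forall>x\<in>B. G x \<le> F x) \<longrightarrow> cvx_fun B G \<longrightarrow> (\<forall>x\<in>B. G x = F x)"
      by (intro allI impI) (rule min')
  qed (rule F'(1), rule ballI, rule F'(3), assumption, rule F'(2))
qed

lemma Hahn_Banach_convex:
  fixes B :: "('a \<Rightarrow> real) set" and q :: "('a \<Rightarrow> real) \<Rightarrow> real"
  assumes ne: "B \<noteq> {}"
    and lin: "\<And>x y a b. x \<in> B \<Longrightarrow> y \<in> B \<Longrightarrow> (\<lambda>z. a * x z + b * y z) \<in> B"
    and q0: "q (\<lambda>z. 0) = 0"
    and qconv: "\<And>x y l. x \<in> B \<Longrightarrow> y \<in> B \<Longrightarrow> 0 \<le> l \<Longrightarrow> l \<le> 1 \<Longrightarrow>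
        q (\<lambda>z. l * x z + (1 - l) * y z) \<le> l * q x + (1 - l) * q y"
  shows "\<exists>F. (\<forall>x\<in>B. F x \<le> q x) \<and>
    (\<forall>x\<in>B. \<forall>y\<in>B. \<forall>a b. F (\<lambda>z. a * x z + b * y z) = a * F x + b * F y)"
proof -
  have "cvx_fun B q" using qconv by (simp add: cvx_fun_def)
  then have "\<exists>F. F (\<lambda>z. 0) = 0 \<and> (\<forall>x\<in>B. F x \<le> q x) \<and> cvx_fun B F \<and>
    (\<forall>G. G (\<lambda>z. 0) = 0 \<longrightarrow> (\<forall>x\<in>B. G x \<le> F x) \<longrightarrow> cvx_fun B G \<longrightarrow> (\<forall>x\<in>B. G x = F x))"
    by (intro ex_minimal_convex_minorant ne q0 lin)
  then obtain F where F0: "F (\<lambda>z. 0) = 0"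
    and Fq: "\<forall>x\<in>B. F x \<le> q x"
    and Fc: "cvx_fun B F"
    and Fm: "\<forall>G. G (\<lambda>z. 0) = 0 \<longrightarrow> (\<forall>x\<in>B. G x \<le> F x) \<longrightarrow> cvx_fun B G \<longrightarrow> (\<forall>x\<in>B. G x = F x)"
    by (elim exE conjE)
  have Fconv: "F (\<lambda>z. l * x z + (1 - l) * y z) \<le> l * F x + (1 - l) * F y"
    if "x \<in> B" "y \<in> B" "0 \<le> l" "l \<le> 1" for x y l
    using Fc that unfolding cvx_fun_def by simp
  have Fmin: "G x = F x" if "G (\<lambda>z. 0) = 0" "\<And>x. x \<in> B \<Longrightarrow> G x \<le> F x"
    "\<And>x y l. x \<in> B \<Longrightarrow> y \<in> B \<Longrightarrow> 0 \<le> l \<Longrightarrow> l \<le> 1 \<Longrightarrow>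
          G (\<lambda>z. l * x z + (1 - l) * y z) \<le> l * G x + (1 - l) * G y" "x \<in> B" for G x
    using Fm[rule_format, of G] that unfolding cvx_fun_def by simp
  have B0: "(\<lambda>z. 0) \<in> B"
    using ne lin[of _ _ 0 0] by auto
  have Bs: "(\<lambda>z. s * x z) \<in> B" if "x \<in> B" for x s
    using lin[OF that that, of s 0] by simp
  have Badd: "(\<lambda>z. x z + y z) \<in> B" if "x \<in> B" "y \<in> B" for x y
    using lin[OF that, of 1 1] by simp
  \<comment> \<open>For \<open>0 < s <= 1\<close>, convexity and \<open>F 0 = 0\<close> make the
    rescaling \<open>F (s x) / s\<close> a convex minorant of \<open>F\<close>, so minimality forces
    equality.\<close>
  have hom1: "F (\<lambda>z. s * x z) = s * F x" if x: "x \<in> B" and s: "0 < s" "s \<le> 1" for x s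
  proof -
    have "F (\<lambda>z. s * x z) / s = F x"
    proof (rule Fmin[of "\<lambda>x. F (\<lambda>z. s * x z) / s"])
      fix x assume x: "x \<in> B"
      have "F (\<lambda>z. s * x z + (1 - s) * 0) \<le> s * F x + (1 - s) * F (\<lambda>z. 0)"
        using Fconv[OF x B0] s by auto
      then show "F (\<lambda>z. s * x z) / s \<le> F x"
        using s F0 by (simp add: field_simps)
    next
      fix x y and l :: real assume xy: "x \<in> B" "y \<in> B" and l: "0 \<le> l" "l \<le> 1"
      have "F (\<lambda>z. l * (s * x z) + (1 - l) * (s * y z)) \<le> l * F (\<lambda>z. s * x z) + (1 - l) * F (\<lambda>z. s * y z)"
        by (rule Fconv) (use xy l Bs in auto)
      also have "(\<lambda>z. l * (s * x z) + (1 - l) * (s * y z)) = (\<lambda>z. s * (l * x z + (1 - l) * y z))"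
        by (auto simp: algebra_simps)
      finally show "F (\<lambda>z. s * (l * x z + (1 - l) * y z)) / s
          \<le> l * (F (\<lambda>z. s * x z) / s) + (1 - l) * (F (\<lambda>z. s * y z) / s)"
        using s by (simp add: field_simps)
    qed (use F0 x in auto)
    then show ?thesis using s by (simp add: field_simps)
  qed
  have hom: "F (\<lambda>z. s * x z) = s * F x" if x: "x \<in> B" and s: "0 \<le> s" for x s
  proof -
    consider "s = 0" | "0 < s" "s \<le> 1" | "s > 1" using s by linarith
    then show ?thesis
    proof cases
      case 3
      have "F (\<lambda>z. (1/s) * (s * x z)) = (1/s) * F (\<lambda>z. s * x z)"
        by (rule hom1) (use 3 Bs x in auto)
      then show ?thesis using 3 by (simp add: field_simps)
    qed (use F0 hom1 x in auto)
  qed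
  have sub: "F (\<lambda>z. x z + y z) \<le> F x + F y" if "x \<in> B" "y \<in> B" for x y
  proof -
    have "F (\<lambda>z. (1/2) * (2 * x z) + (1 - 1/2) * (2 * y z))
        \<le> (1/2) * F (\<lambda>z. 2 * x z) + (1 - 1/2) * F (\<lambda>z. 2 * y z)"
      by (rule Fconv) (use Bs that in auto)
    then show ?thesis using hom that by simp
  qed
  have super: "F x + F y \<le> F (\<lambda>z. x z + y z)" if x: "x \<in> B" and y: "y \<in> B" for x y
  proof -
    \<comment> \<open>The directional modification along \<open>y\<close>. Homogeneity gives
      \<open>G 0 = 0\<close>, subadditivity bounds it below by \<open>- F (- x)\<close>, and
      \<open>t = 0\<close> shows \<open>G x <= F x\<close>. Once \<open>G = F\<close>, the choice
      \<open>t = 1\<close> is superadditivity.\<close>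
    define G where "G x = (INF t\<in>{0..}. F (\<lambda>z. x z + t * y z) - t * F y)" for x
    have bdd: "bdd_below ((\<lambda>t. F (\<lambda>z. x z + t * y z) - t * F y) ` {0..})" if x: "x \<in> B" for x
    proof (rule bdd_belowI2[where m="- F (\<lambda>z. (-1) * x z)"])
      fix t :: real assume t: "t \<in> {0..}"
      have "F (\<lambda>z. (x z + t * y z) + (-1) * x z) \<le> F (\<lambda>z. x z + t * y z) + F (\<lambda>z. (-1) * x z)"
        by (rule sub[OF Badd[OF x Bs[OF y]] Bs[OF x]])
      then show "- F (\<lambda>z. (-1) * x z) \<le> F (\<lambda>z. x z + t * y z) - t * F y"
        using hom[OF y, of t] t by simp
    qed
    have G_le: "G x \<le> F (\<lambda>z. x z + t * y z) - t * F y" if "x \<in> B" "t \<ge> 0" for x t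
      unfolding G_def by (rule cINF_lower[OF bdd[OF that(1)]]) (use that in auto)
    have G_ap: "\<exists>t\<ge>0. F (\<lambda>z. x z + t * y z) - t * F y < G x + e" if "x \<in> B" "e > 0" for x and e :: real
      using cINF_less_iff[OF _ bdd[OF that(1)], of "G x + e"] that unfolding G_def by auto
    have "G x = F x"
    proof (rule Fmin[of G])
      show "G (\<lambda>z. 0) = 0"
        using hom[OF y] by (simp add: G_def)
    next
      fix x assume "x \<in> B" then show "G x \<le> F x" using G_le[of x 0] by simp
    next
      fix x w and l :: real assume xw: "x \<in> B" "w \<in> B" and l: "0 \<le> l" "l \<le> 1"
      show "G (\<lambda>z. l * x z + (1 - l) * w z) \<le> l * G x + (1 - l) * G w"
      proof (rule field_le_epsilon)
        fix e :: real assume "e > 0"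
        obtain s where s: "s \<ge> 0" "F (\<lambda>z. x z + s * y z) - s * F y < G x + e"
          using G_ap xw \<open>e > 0\<close> by blast
        obtain t where t: "t \<ge> 0" "F (\<lambda>z. w z + t * y z) - t * F y < G w + e"
          using G_ap xw \<open>e > 0\<close> by blast
        \<comment> \<open>The convex combination of the two shifts, so that the
          \<open>y\<close>-terms of the combined arguments add up to \<open>r * y\<close>.\<close>
        define r where "r = l * s + (1 - l) * t"
        have "r \<ge> 0" using s t l by (simp add: r_def)
        have "G (\<lambda>z. l * x z + (1 - l) * w z) \<le> F (\<lambda>z. (l * x z + (1 - l) * w z) + r * y z) - r * F y"
          by (rule G_le) (use xw \<open>r \<ge> 0\<close> lin in auto)
        also have "(\<lambda>z. (l * x z + (1 - l) * w z) + r * y z)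
            = (\<lambda>z. l * (x z + s * y z) + (1 - l) * (w z + t * y z))"
          by (auto simp: r_def algebra_simps)
        also have "F \<dots> \<le> l * F (\<lambda>z. x z + s * y z) + (1 - l) * F (\<lambda>z. w z + t * y z)"
          by (rule Fconv) (use l xw y Badd Bs in auto)
        also have "\<dots> - r * F y = l * (F (\<lambda>z. x z + s * y z) - s * F y)
            + (1 - l) * (F (\<lambda>z. w z + t * y z) - t * F y)"
          by (simp add: r_def algebra_simps)
        also have "\<dots> \<le> l * (G x + e) + (1 - l) * (G w + e)"
          using s t l by (intro add_mono mult_left_mono) auto
        also have "\<dots> = l * G x + (1 - l) * G w + e" by (simp add: algebra_simps)
        finally show "G (\<lambda>z. l * x z + (1 - l) * w z) \<le> l * G x + (1 - l) * G w + e" by simp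
      qed
    qed (use x in auto)
    then show ?thesis using G_le[OF x, of 1] by simp
  qed
  have add: "F (\<lambda>z. x z + y z) = F x + F y" if "x \<in> B" "y \<in> B" for x y
    using sub super that by (simp add: antisym)
  have neg: "F (\<lambda>z. - x z) = - F x" if "x \<in> B" for x
    using add[OF that Bs[OF that, of "-1"]] F0 by simp
  have scale: "F (\<lambda>z. s * x z) = s * F x" if "x \<in> B" for x s
  proof (cases "s \<ge> 0")
    case False
    then show ?thesis using neg[OF Bs[OF that, of "-s"]] hom[OF that, of "-s"] by simp
  qed (use hom that in auto)
  have "F (\<lambda>z. a * x z + b * y z) = a * F x + b * F y" if "x \<in> B" "y \<in> B" for x y a b
    using add[OF Bs[OF that(1)] Bs[OF that(2)]] scale that by simp
  then show ?thesis using Fq by blast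
qed

section \<open>Daniell representation\<close>

text \<open>\<open>B\<close> is a vector lattice with constants, so truncations stay in
  \<open>B\<close>. Its members are total functions of which only the values on \<open>X\<close>
  count, whence \<open>cong\<close>. The last assumption is Daniell's continuity condition.\<close>

locale daniell =
  fixes X :: "'a set" and B :: "('a \<Rightarrow> real) set" and L :: "('a \<Rightarrow> real) \<Rightarrow> real"
  assumes lin: "\<And>x y a b. x \<in> B \<Longrightarrow> y \<in> B \<Longrightarrow> (\<lambda>z. a * x z + b * y z) \<in> B"
    and one: "(\<lambda>z. 1) \<in> B"
    and max: "\<And>x y. x \<in> B \<Longrightarrow> y \<in> B \<Longrightarrow> (\<lambda>z. max (x z) (y z)) \<in> B"
    and cong: "\<And>x y. x \<in> B \<Longrightarrow> (\<And>z. z \<in> X \<Longrightarrow> x z = y z) \<Longrightarrow> y \<in> B"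
    and L_lin: "\<And>x y a b. x \<in> B \<Longrightarrow> y \<in> B \<Longrightarrow> L (\<lambda>z. a * x z + b * y z) = a * L x + b * L y"
    and L_pos: "\<And>x. x \<in> B \<Longrightarrow> (\<And>z. z \<in> X \<Longrightarrow> 0 \<le> x z) \<Longrightarrow> 0 \<le> L x"
    and L_cont: "\<And>g. (\<And>n. g n \<in> B) \<Longrightarrow> (\<And>z n. z \<in> X \<Longrightarrow> g (Suc n) z \<le> g n z) \<Longrightarrow>
        (\<And>z. z \<in> X \<Longrightarrow> (\<lambda>n. g n z) \<longlonglongrightarrow> 0) \<Longrightarrow> (\<lambda>n. L (g n)) \<longlonglongrightarrow> 0"
begin

lemma scale: "x \<in> B \<Longrightarrow> (\<lambda>z. a * x z) \<in> B"
  using lin[of x x a 0] by simp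

lemma add: "x \<in> B \<Longrightarrow> y \<in> B \<Longrightarrow> (\<lambda>z. x z + y z) \<in> B"
  using lin[of x y 1 1] by simp

lemma diff: "x \<in> B \<Longrightarrow> y \<in> B \<Longrightarrow> (\<lambda>z. x z - y z) \<in> B"
  using lin[of x y 1 "-1"] by simp

lemma const: "(\<lambda>z. a) \<in> B"
  using scale[OF one, of a] by simp

lemma min: "x \<in> B \<Longrightarrow> y \<in> B \<Longrightarrow> (\<lambda>z. min (x z) (y z)) \<in> B"
  using scale[OF max[OF scale[of x "-1"] scale[of y "-1"]], of "-1"]
  by (simp add: minus_max_eq_min)

lemma L_scale: "x \<in> B \<Longrightarrow> L (\<lambda>z. a * x z) = a * L x"
  using L_lin[of x x a 0] by simp

lemma L_add: "x \<in> B \<Longrightarrow> y \<in> B \<Longrightarrow> L (\<lambda>z. x z + y z) = L x + L y"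
  using L_lin[of x y 1 1] by simp

lemma L_diff: "x \<in> B \<Longrightarrow> y \<in> B \<Longrightarrow> L (\<lambda>z. x z - y z) = L x - L y"
  using L_lin[of x y 1 "-1"] by simp

lemma L_zero: "L (\<lambda>z. 0) = 0"
  using L_scale[OF one, of 0] by simp

lemma L_mono:
  assumes "x \<in> B" "y \<in> B" "\<And>z. z \<in> X \<Longrightarrow> x z \<le> y z"
  shows "L x \<le> L y"
  using L_pos[OF diff[OF assms(2,1)]] L_diff[OF assms(2,1)] assms(3) by simp

lemma L_cong:
  assumes "x \<in> B" "\<And>z. z \<in> X \<Longrightarrow> x z = y z"
  shows "L x = L y"
  using assms cong[OF assms] by (intro antisym L_mono) auto

lemma sum:
  assumes "\<And>i. i \<in> I \<Longrightarrow> x i \<in> B"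
  shows "(\<lambda>z. \<Sum>i\<in>I. x i z) \<in> B"
  using assms by (induction I rule: infinite_finite_induct) (auto intro: const add)

lemma L_sum:
  assumes "\<And>i. i \<in> I \<Longrightarrow> x i \<in> B"
  shows "L (\<lambda>z. \<Sum>i\<in>I. x i z) = (\<Sum>i\<in>I. L (x i))"
  using assms
proof (induction I rule: infinite_finite_induct)
  case (insert i I)
  then show ?case by (simp add: L_add sum)
qed (simp_all add: L_zero)

section \<open>The premeasure on regions between two graphs\<close>

definition strip :: "('a \<Rightarrow> real) \<Rightarrow> ('a \<Rightarrow> real) \<Rightarrow> ('a \<times> real) set" where
  "strip f g = {(x, t). x \<in> X \<and> f x \<le> t \<and> t < g x}"

text \<open>Working in \<open>X \<times> UNIV\<close> rather than in \<open>X\<close> lets the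
  lattice operations of \<open>B\<close> produce a semiring directly. Half-open fibres make
  intersections and differences fit together without overlap.\<close>

definition strips :: "('a \<times> real) set set" where
  "strips = {strip f g | f g. f \<in> B \<and> g \<in> B \<and> (\<forall>x\<in>X. f x \<le> g x)}"

text \<open>Written through Lebesgue measure, it depends on the set alone, so
  \<open>L (fibre_len A)\<close> requires no choice of bounding graphs for \<open>A\<close>.\<close>

definition fibre_len :: "('a \<times> real) set \<Rightarrow> 'a \<Rightarrow> real" where
  "fibre_len A x = measure lborel {t. (x, t) \<in> A}"

lemma stripsI: "f \<in> B \<Longrightarrow> g \<in> B \<Longrightarrow> (\<And>x. x \<in> X \<Longrightarrow> f x \<le> g x) \<Longrightarrow> strip f g \<in> strips"
  unfolding strips_def by blast

lemma stripsE:
  assumes "A \<in> strips"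
  obtains f g where "f \<in> B" "g \<in> B" "\<And>x. x \<in> X \<Longrightarrow> f x \<le> g x" "A = strip f g"
  using assms unfolding strips_def by blast

lemma fibre_strip: "x \<in> X \<Longrightarrow> {t. (x, t) \<in> strip f g} = {f x..<g x}"
  by (auto simp: strip_def)

lemma fibre_len_strip: "x \<in> X \<Longrightarrow> f x \<le> g x \<Longrightarrow> fibre_len (strip f g) x = g x - f x"
  by (simp add: fibre_len_def fibre_strip)

lemma fibre_len_in:
  assumes "A \<in> strips"
  shows "fibre_len A \<in> B"
proof -
  obtain f g where *: "f \<in> B" "g \<in> B" "\<And>x. x \<in> X \<Longrightarrow> f x \<le> g x" "A = strip f g"
    using stripsE[OF assms] by blast
  show ?thesis
    by (rule cong[OF diff[OF *(2,1)]]) (simp add: * fibre_len_strip)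
qed

lemma fibre_len_nonneg: "0 \<le> fibre_len A x"
  by (simp add: fibre_len_def)

lemma L_fibre_len_strip:
  assumes "f \<in> B" "g \<in> B" "\<And>x. x \<in> X \<Longrightarrow> f x \<le> g x"
  shows "L (fibre_len (strip f g)) = L g - L f"
  unfolding L_diff[OF assms(2,1), symmetric]
  by (rule L_cong[OF fibre_len_in[OF stripsI[OF assms]]]) (simp_all add: fibre_len_strip assms)

lemma semiring_strips: "semiring_of_sets (X \<times> UNIV) strips"
proof
  show "strips \<subseteq> Pow (X \<times> UNIV)"
    by (auto simp: strips_def strip_def)
  have "strip (\<lambda>z. 0) (\<lambda>z. 0) = {}" by (auto simp: strip_def)
  then show "{} \<in> strips" using stripsI[OF const const, of 0 0] by simp
next
  fix a b assume "a \<in> strips" "b \<in> strips"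
  then obtain f g f' g' where *: "f \<in> B" "g \<in> B" "\<And>x. x \<in> X \<Longrightarrow> f x \<le> g x" "a = strip f g"
      "f' \<in> B" "g' \<in> B" "\<And>x. x \<in> X \<Longrightarrow> f' x \<le> g' x" "b = strip f' g'"
    by (auto elim!: stripsE)
  \<comment> \<open>The outer \<open>max\<close> collapses the strip to an empty fibre wherever the
    two fibres do not meet, which keeps the upper graph above the lower one.\<close>
  have "a \<inter> b = strip (\<lambda>x. max (f x) (f' x)) (\<lambda>x. max (max (f x) (f' x)) (min (g x) (g' x)))"
    unfolding * strip_def by auto
  also have "\<dots> \<in> strips"
    by (intro stripsI max min *) auto
  finally show "a \<inter> b \<in> strips" .
  \<comment> \<open>The part of \<open>a\<close> below \<open>b\<close> and the part above it, each
    clipped to stay between the graphs bounding \<open>a\<close>.\<close>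
  let ?C = "{strip f (\<lambda>x. max (f x) (min (g x) (f' x))), strip (\<lambda>x. min (g x) (max (f x) (g' x))) g}"
  have "?C \<subseteq> strips"
    using * by (auto intro!: stripsI max min)
  moreover have "disjoint ?C"
  proof -
    have False if "(x, t) \<in> strip f (\<lambda>x. max (f x) (min (g x) (f' x)))"
      "(x, t) \<in> strip (\<lambda>x. min (g x) (max (f x) (g' x))) g" for x t
      using that *(7)[of x] by (auto simp: strip_def max_def min_def split: if_splits)
    then show ?thesis unfolding disjoint_def by fast
  qed
  moreover have "a - b = \<Union>?C"
  proof (intro set_eqI, clarify)
    fix x t
    show "(x, t) \<in> a - b \<longleftrightarrow> (x, t) \<in> \<Union>?C"
      using *(3)[of x] *(7)[of x] unfolding *(4,8)
      by (cases "x \<in> X") (auto simp: strip_def less_max_iff_disj min_le_iff_disj not_less)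
  qed
  ultimately show "\<exists>C\<subseteq>strips. finite C \<and> disjoint C \<and> a - b = \<Union> C"
    by (intro exI[of _ ?C]) auto
qed

interpretation strips: semiring_of_sets "X \<times> UNIV" strips
  by (rule semiring_strips)

text \<open>Countable additivity reduces to that of Lebesgue measure on each fibre, because the
  fibre lengths of a disjoint union increase pointwise to that of the union.\<close>

lemma countably_additive_strips: "countably_additive strips (\<lambda>A. ennreal (L (fibre_len A)))"
proof (rule countably_additiveI)
  fix A :: "nat \<Rightarrow> _"
  assume A: "range A \<subseteq> strips" "disjoint_family A" "(\<Union>i. A i) \<in> strips"
  let ?U = "\<Union>i. A i"
  have AB: "fibre_len (A i) \<in> B" for i using A by (auto intro: fibre_len_in)
  have UB: "fibre_len ?U \<in> B" using A by (auto intro: fibre_len_in)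
  define g where "g n x = fibre_len ?U x - (\<Sum>i<n. fibre_len (A i) x)" for n x
  have gB: "g n \<in> B" for n unfolding g_def by (intro diff UB sum AB)
  have fib: "{t. (x, t) \<in> S} \<in> sets lborel" "emeasure lborel {t. (x, t) \<in> S} \<noteq> \<infinity>"
    if "x \<in> X" "S \<in> strips" for x S
    using that by (auto elim!: stripsE simp: fibre_strip)
  have sums: "(\<lambda>i. fibre_len (A i) x) sums fibre_len ?U x" if x: "x \<in> X" for x
  proof -
    have "(\<lambda>i. measure lborel {t. (x, t) \<in> A i}) sums measure lborel (\<Union>i. {t. (x, t) \<in> A i})"
    proof (rule measure_UNION)
      show "disjoint_family (\<lambda>i. {t. (x, t) \<in> A i})"
        using A(2) by (auto simp: disjoint_family_on_def)
      have "(\<Union>i. {t. (x, t) \<in> A i}) = {t. (x, t) \<in> ?U}" by auto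
      then show "emeasure lborel (\<Union>i. {t. (x, t) \<in> A i}) \<noteq> \<infinity>" using fib[OF x A(3)] by simp
      show "range (\<lambda>i. {t. (x, t) \<in> A i}) \<subseteq> sets lborel" using fib x A by auto
    qed
    moreover have "(\<Union>i. {t. (x, t) \<in> A i}) = {t. (x, t) \<in> ?U}" by auto
    ultimately show ?thesis unfolding fibre_len_def by simp
  qed
  have "(\<lambda>n. L (g n)) \<longlonglongrightarrow> 0"
  proof (rule L_cont[OF gB])
    fix z assume z: "z \<in> X"
    show "g (Suc n) z \<le> g n z" for n by (simp add: g_def fibre_len_nonneg)
    have "(\<lambda>n. fibre_len ?U z - (\<Sum>i<n. fibre_len (A i) z)) \<longlonglongrightarrow> fibre_len ?U z - fibre_len ?U z"
      using sums[OF z] unfolding sums_def by (intro tendsto_intros)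
    then show "(\<lambda>n. g n z) \<longlonglongrightarrow> 0" by (simp add: g_def)
  qed
  moreover have "L (g n) = L (fibre_len ?U) - (\<Sum>i<n. L (fibre_len (A i)))" for n
    unfolding g_def using UB AB by (subst L_diff) (auto intro: sum simp: L_sum)
  ultimately have "(\<lambda>n. L (fibre_len ?U) - (L (fibre_len ?U) - (\<Sum>i<n. L (fibre_len (A i)))))
      \<longlonglongrightarrow> L (fibre_len ?U) - 0"
    by (intro tendsto_intros) simp
  then have "(\<lambda>i. L (fibre_len (A i))) sums L (fibre_len ?U)" by (simp add: sums_def)
  then show "(\<Sum>i. ennreal (L (fibre_len (A i)))) = ennreal (L (fibre_len ?U))"
    by (intro suminf_ennreal_eq L_pos AB fibre_len_nonneg)
qed

lemma ex_strip_measure: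
  obtains N where "space N = X \<times> UNIV" "sets N = sigma_sets (X \<times> UNIV) strips"
    "\<And>f g. f \<in> B \<Longrightarrow> g \<in> B \<Longrightarrow> (\<And>x. x \<in> X \<Longrightarrow> f x \<le> g x) \<Longrightarrow>
        emeasure N (strip f g) = ennreal (L g - L f)"
proof -
  have pos: "positive strips (\<lambda>A. ennreal (L (fibre_len A)))"
    using L_zero by (auto simp: positive_def fibre_len_def[abs_def])
  obtain \<mu> where \<mu>: "\<And>s. s \<in> strips \<Longrightarrow> \<mu> s = ennreal (L (fibre_len s))"
    "measure_space (X \<times> UNIV) (sigma_sets (X \<times> UNIV) strips) \<mu>"
    using strips.caratheodory[OF pos countably_additive_strips] by blast
  let ?N = "measure_of (X \<times> UNIV) strips \<mu>"
  have "emeasure ?N (strip f g) = ennreal (L g - L f)"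
    if "f \<in> B" "g \<in> B" "\<And>x. x \<in> X \<Longrightarrow> f x \<le> g x" for f g
    using that \<mu> stripsI[OF that] strips.space_closed
    by (subst emeasure_measure_of[OF refl])
       (auto simp: measure_space_def L_fibre_len_strip)
  then show thesis
    using strips.space_closed by (intro that[of ?N]) auto
qed

text \<open>A discrete layer-cake formula: unit layers of \<open>y\<close> up to height
  \<open>m\<close>.\<close>

lemma sum_clamp:
  fixes y :: real
  assumes "0 \<le> y"
  shows "(\<Sum>k<m. max 0 (min 1 (y - real k))) = min y (real m)"
  using assms by (induction m) auto

text \<open>The mass of \<open>A\<close> is that of the cylinder of height 1 over \<open>A\<close>.
  Layers of a function lie between indicators of consecutive level sets, on which \<open>L\<close>
  and the integral obey the same bounds; refining the layers makes the two agree.\<close>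

theorem daniell_representation:
  obtains M where "space M = X"
    "\<And>g. g \<in> B \<Longrightarrow> integrable M g" "\<And>g. g \<in> B \<Longrightarrow> integral\<^sup>L M g = L g"
proof -
  obtain N where N: "space N = X \<times> UNIV" "sets N = sigma_sets (X \<times> UNIV) strips"
    and emN: "\<And>f g. f \<in> B \<Longrightarrow> g \<in> B \<Longrightarrow> (\<And>x. x \<in> X \<Longrightarrow> f x \<le> g x) \<Longrightarrow>
        emeasure N (strip f g) = ennreal (L g - L f)"
    using ex_strip_measure by blast
  have stripN: "strip f g \<in> sets N" if "f \<in> B" "g \<in> B" "\<And>x. x \<in> X \<Longrightarrow> f x \<le> g x" for f g
    unfolding N(2) using stripsI[OF that] by auto
  \<comment> \<open>Positivity sets generate a sigma-algebra on \<open>X\<close> for which all of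
    \<open>B\<close> is measurable, since subtracting constants stays in \<open>B\<close>.\<close>
  define G where "G = {{x\<in>X. 0 < g x} | g. g \<in> B}"
  define N1 where "N1 = restrict_space N (X \<times> {0..<1})"
  define M where "M = distr N1 (sigma X G) fst"
  have GX: "G \<subseteq> Pow X" by (auto simp: G_def)
  have unit: "X \<times> {0..<1} = strip (\<lambda>z. 0) (\<lambda>z. 1)" by (auto simp: strip_def)
  have unitN: "X \<times> {0..<1} \<in> sets N" unfolding unit by (intro stripN const) auto
  have spN1: "space N1 = X \<times> {0..<1}" unfolding N1_def by (auto simp: space_restrict_space N)
  have setsN1: "sets N1 = {S. S \<subseteq> X \<times> {0..<1} \<and> S \<in> sets N}"
    using sets_restrict_space_iff[of "X \<times> {0..<1}" N] unitN sets.sets_into_space[OF unitN]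
    by (intro set_eqI) (simp add: N1_def Int_absorb2)
  have "fst -` A \<inter> space N1 \<in> sets N1" if A: "A \<in> G" for A
  proof -
    obtain g where g: "g \<in> B" "A = {x\<in>X. 0 < g x}" using A unfolding G_def by blast
    have "fst -` A \<inter> space N1 = (\<Union>n. strip (\<lambda>z. 0) (\<lambda>z. min 1 (max 0 (real n * g z))))"
    proof -
      \<comment> \<open>The cylinder over the positivity set of \<open>g\<close> is exhausted by the
        strips under \<open>n * g\<close> clipped to \<open>[0,1]\<close>; this is what makes the
        projection measurable.\<close>
      have "(\<exists>n. t < min 1 (max 0 (real n * g x))) \<longleftrightarrow> 0 < g x \<and> t < 1" if "0 \<le> t" for x and t :: real
      proof
        assume *: "0 < g x \<and> t < 1"
        obtain n where "1 / g x < real n" using reals_Archimedean2 by blast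
        then have "1 < real n * g x" using * by (simp add: field_simps)
        then show "\<exists>n. t < min 1 (max 0 (real n * g x))"
          using * by (intro exI[of _ n]) auto
      qed (use that in \<open>auto simp: less_max_iff_disj zero_less_mult_iff dest: le_less_trans\<close>)
      then have "x \<in> A \<and> (x, t) \<in> X \<times> {0..<1} \<longleftrightarrow>
          (\<exists>n. (x, t) \<in> strip (\<lambda>z. 0) (\<lambda>z. min 1 (max 0 (real n * g z))))" for x t
        unfolding strip_def g(2) by (cases "0 \<le> t") (simp_all, blast)
      note * = this
      show ?thesis unfolding spN1
      proof (rule set_eqI)
        fix p
        show "p \<in> fst -` A \<inter> X \<times> {0..<1} \<longleftrightarrow>
            p \<in> (\<Union>n. strip (\<lambda>z. 0) (\<lambda>z. min 1 (max 0 (real n * g z))))"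
          using *[of "fst p" "snd p"] by simp
      qed
    qed
    moreover have "\<dots> \<in> sets N"
      by (intro sets.countable_UN image_subsetI stripN min max const scale g) auto
    ultimately have "fst -` A \<inter> space N1 \<in> sets N" by simp
    then show ?thesis using spN1 setsN1 by auto
  qed
  then have fstM: "fst \<in> measurable N1 (sigma X G)"
    using GX by (intro measurable_sigma_sets[OF sets_measure_of]) (auto simp: spN1)
  have spM: "space M = X" using GX by (simp add: M_def)
  have emM: "emeasure M A = emeasure N (A \<times> {0..<1})" "A \<times> {0..<1} \<in> sets N" if A: "A \<in> sets M" for A
  proof -
    have AX: "A \<subseteq> X" using A sets.sets_into_space spM by blast
    have *: "fst -` A \<inter> space N1 = A \<times> {0..<1}" using AX by (auto simp: spN1)
    have "A \<times> {0..<1} \<in> sets N1"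
      using measurable_sets[OF fstM, of A] A * by (simp add: M_def)
    then show "A \<times> {0..<1} \<in> sets N"
      by (simp add: setsN1)
    show "emeasure M A = emeasure N (A \<times> {0..<1})"
    proof -
      have "emeasure M A = emeasure N1 (A \<times> {0..<1})"
        using A * unfolding M_def by (subst emeasure_distr[OF fstM]) auto
      also have "\<dots> = emeasure N (A \<times> {0..<1})"
        unfolding N1_def using AX unitN sets.sets_into_space[OF unitN]
        by (intro emeasure_restrict_space) (auto simp: Int_absorb2)
      finally show ?thesis .
    qed
  qed
  have pos_sets: "{x\<in>X. a < g x} \<in> sets M" if g: "g \<in> B" for g a
  proof -
    have "{x\<in>X. a < g x} \<in> G"
      unfolding G_def using diff[OF g const[of a]] by (intro CollectI exI[of _ "\<lambda>z. g z - a"]) auto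
    then show ?thesis using GX by (simp add: M_def)
  qed
  have meas: "g \<in> borel_measurable M" if "g \<in> B" for g
    using pos_sets[OF that] spM by (auto simp: borel_measurable_iff_greater)
  have fin: "finite_measure M"
  proof
    have "emeasure M X = ennreal (L (\<lambda>z. 1) - L (\<lambda>z. 0))"
      using emM(1)[of X] sets.top[of M] spM unit emN[OF const const, of 0 1] by simp
    then show "emeasure M (space M) \<noteq> \<infinity>" by (simp add: spM)
  qed
  interpret finite_measure M by fact
  \<comment> \<open>Here and in \<open>lower\<close>, comparing the cylinder over \<open>A\<close>
    with the strip under \<open>h\<close> turns an inequality between \<open>h\<close> and an
    indicator into one between \<open>L h\<close> and the measure of \<open>A\<close>.\<close>
  have upper: "measure M A \<le> L h" if "A \<in> sets M" "h \<in> B" "\<And>z. z \<in> X \<Longrightarrow> indicator A z \<le> h z" for A h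
  proof -
    note h = that
    have h0: "0 \<le> h z" if "z \<in> X" for z
      using h(3)[OF that] by (cases "z \<in> A") auto
    have "A \<subseteq> X" using that(1) sets.sets_into_space spM by blast
    then have "A \<times> {0..<1} \<subseteq> strip (\<lambda>z. 0) h"
      using that(3) by (fastforce simp: strip_def indicator_def)
    then have "emeasure M A \<le> emeasure N (strip (\<lambda>z. 0) h)"
      unfolding emM(1)[OF that(1)] using h0 by (intro emeasure_mono stripN const that) auto
    also have "\<dots> = ennreal (L h)" using emN[OF const that(2), of 0] h0 L_zero by simp
    finally show ?thesis using L_pos[OF that(2) h0] by (simp add: emeasure_eq_measure)
  qed
  have lower: "L h \<le> measure M A" if "A \<in> sets M" "h \<in> B" "\<And>z. z \<in> X \<Longrightarrow> h z \<le> indicator A z"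
      "\<And>z. z \<in> X \<Longrightarrow> 0 \<le> h z" for A h
  proof -
    have "strip (\<lambda>z. 0) h \<subseteq> A \<times> {0..<1}"
    proof (intro subrelI)
      fix x t assume "(x, t) \<in> strip (\<lambda>z. 0) h"
      then show "(x, t) \<in> A \<times> {0..<1}"
        using that(3)[of x] by (cases "x \<in> A") (auto simp: strip_def)
    qed
    then have "emeasure N (strip (\<lambda>z. 0) h) \<le> emeasure M A"
      unfolding emM(1)[OF that(1)] using emM(2)[OF that(1)] by (intro emeasure_mono) auto
    moreover have "emeasure N (strip (\<lambda>z. 0) h) = ennreal (L h)"
      using emN[OF const that(2), of 0] that(4) L_zero by simp
    ultimately show ?thesis using L_pos[OF that(2,4)] by (simp add: emeasure_eq_measure)
  qed
  \<comment> \<open>The truncation at \<open>n\<close> is cut into \<open>n*n\<close> layers of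
    height \<open>1/n\<close>. For the \<open>k\<close>-th one, both \<open>L\<close> and the
    integral lie between \<open>a (Suc k)\<close> and \<open>a k\<close>, so the differences
    telescope to at most the total mass, times \<open>1/n\<close>.\<close>
  have approx: "\<bar>L (\<lambda>z. min (g z) (real n)) - (\<integral>z. min (g z) (real n) \<partial>M)\<bar> \<le> measure M X / real n"
    if g: "g \<in> B" and g0: "\<And>z. z \<in> X \<Longrightarrow> 0 \<le> g z" and n: "n > 0" for g n
  proof -
    define h where "h k z = max 0 (min 1 (real n * g z - real k))" for k :: nat and z
    have hB: "h k \<in> B" for k unfolding h_def by (intro max min const diff scale g)
    have hint: "integrable M (h k)" for k
      by (rule integrable_const_bound[of _ 1]) (auto intro!: meas hB simp: h_def)
    have eq: "min (g z) (real n) = (1 / real n) * (\<Sum>k<n*n. h k z)" if "z \<in> X" for z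
    proof -
      have "(\<Sum>k<n*n. h k z) = min (real n * g z) (real (n * n))"
        unfolding h_def using g0[OF that] by (intro sum_clamp) auto
      also have "\<dots> = real n * min (g z) (real n)"
        by (simp add: min_mult_distrib_left)
      finally show ?thesis using n by simp
    qed
    define a where "a k = measure M {z\<in>X. real k < real n * g z}" for k
    have aset: "{z\<in>X. real k < real n * g z} \<in> sets M" for k
      using pos_sets[OF scale[OF g]] by blast
    have b1: "a (Suc k) \<le> L (h k)" "L (h k) \<le> a k" for k
      unfolding a_def by (intro upper lower aset hB; auto simp: h_def indicator_def)+
    have b2: "a (Suc k) \<le> integral\<^sup>L M (h k)" "integral\<^sup>L M (h k) \<le> a k" for k
    proof -
      have "(\<integral>z. indicator {z\<in>X. real (Suc k) < real n * g z} z \<partial>M) \<le> integral\<^sup>L M (h k)"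
        by (intro integral_mono hint integrable_real_indicator aset)
           (auto simp: h_def indicator_def emeasure_eq_measure)
      then show "a (Suc k) \<le> integral\<^sup>L M (h k)" using aset[of "Suc k"] by (simp add: a_def)
      have "integral\<^sup>L M (h k) \<le> (\<integral>z. indicator {z\<in>X. real k < real n * g z} z \<partial>M)"
        by (intro integral_mono hint integrable_real_indicator aset)
           (auto simp: h_def indicator_def emeasure_eq_measure spM)
      then show "integral\<^sup>L M (h k) \<le> a k" using aset[of k] by (simp add: a_def)
    qed
    have L1: "L (\<lambda>z. min (g z) (real n)) = (1 / real n) * (\<Sum>k<n*n. L (h k))"
    proof -
      have "L (\<lambda>z. min (g z) (real n)) = L (\<lambda>z. (1 / real n) * (\<Sum>k<n*n. h k z))"
        by (rule L_cong) (use eq in \<open>auto intro: min g const\<close>)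
      also have "\<dots> = (1 / real n) * (\<Sum>k<n*n. L (h k))"
        using hB by (subst L_scale) (auto intro: sum simp: L_sum)
      finally show ?thesis .
    qed
    have I1: "(\<integral>z. min (g z) (real n) \<partial>M) = (1 / real n) * (\<Sum>k<n*n. integral\<^sup>L M (h k))"
    proof -
      have "(\<integral>z. min (g z) (real n) \<partial>M) = (\<integral>z. (1 / real n) * (\<Sum>k<n*n. h k z) \<partial>M)"
        by (rule Bochner_Integration.integral_cong) (use eq spM in auto)
      then show ?thesis using hint by (simp add: Bochner_Integration.integral_sum)
    qed
    have "\<bar>(\<Sum>k<n*n. L (h k)) - (\<Sum>k<n*n. integral\<^sup>L M (h k))\<bar>
        \<le> (\<Sum>k<n*n. \<bar>L (h k) - integral\<^sup>L M (h k)\<bar>)"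
      unfolding sum_subtractf[symmetric] by (rule sum_abs)
    also have "\<dots> \<le> (\<Sum>k<n*n. a k - a (Suc k))"
      using b1 b2 by (intro sum_mono) (smt (verit))
    also have "\<dots> = a 0 - a (n * n)" by (rule sum_lessThan_telescope')
    also have "\<dots> \<le> measure M X"
    proof -
      have "a 0 \<le> measure M X"
        unfolding a_def using spM sets.top[of M] by (intro finite_measure_mono) auto
      moreover have "0 \<le> a (n * n)" by (simp add: a_def)
      ultimately show ?thesis by linarith
    qed
    finally have "\<bar>(\<Sum>k<n*n. L (h k)) - (\<Sum>k<n*n. integral\<^sup>L M (h k))\<bar> / real n \<le> measure M X / real n"
      using n by (intro divide_right_mono) auto
    then show ?thesis
      unfolding L1 I1 right_diff_distrib[symmetric] abs_mult using n by simp
  qed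
  have nonneg: "integrable M g \<and> integral\<^sup>L M g = L g" if g: "g \<in> B" and g0: "\<And>z. z \<in> X \<Longrightarrow> 0 \<le> g z" for g
  proof -
    have mB: "(\<lambda>z. min (g z) (real n)) \<in> B" for n by (intro min g const)
    \<comment> \<open>The truncation is removed for \<open>L\<close> by Daniell continuity, and for
      the integral by monotone convergence.\<close>
    have "(\<lambda>n. L (\<lambda>z. g z - min (g z) (real n))) \<longlonglongrightarrow> 0"
    proof (rule L_cont)
      show "(\<lambda>z. g z - min (g z) (real n)) \<in> B" for n by (intro diff g mB)
      fix z
      have "\<forall>\<^sub>F n in sequentially. g z - min (g z) (real n) = 0"
        using eventually_ge_at_top[of "nat \<lceil>g z\<rceil>"]
        by eventually_elim (auto simp: min_def not_le dest: ceiling_le_iff[THEN iffD1] intro: real_nat_ceiling_ge[THEN order_trans])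
      then show "(\<lambda>n. g z - min (g z) (real n)) \<longlonglongrightarrow> 0" by (rule tendsto_eventually)
    qed auto
    then have "(\<lambda>n. L g - (L g - L (\<lambda>z. min (g z) (real n)))) \<longlonglongrightarrow> L g - 0"
      unfolding L_diff[OF g mB] by (intro tendsto_intros)
    then have Llim: "(\<lambda>n. L (\<lambda>z. min (g z) (real n))) \<longlonglongrightarrow> L g" by simp
    have "(\<lambda>n. L (\<lambda>z. min (g z) (real n)) - (\<integral>z. min (g z) (real n) \<partial>M)) \<longlonglongrightarrow> 0"
    proof (rule tendsto_0_le[of "\<lambda>n. measure M X / real n" sequentially _ 1])
      show "(\<lambda>n. measure M X / real n) \<longlonglongrightarrow> 0" by (rule lim_const_over_n)
      show "\<forall>\<^sub>F n in sequentially. norm (L (\<lambda>z. min (g z) (real n)) - (\<integral>z. min (g z) (real n) \<partial>M))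
          \<le> norm (measure M X / real n) * 1"
        using eventually_gt_at_top[of 0] by eventually_elim (use approx[OF g g0] in auto)
    qed
    from tendsto_diff[OF Llim this]
    have Ilim: "(\<lambda>n. \<integral>z. min (g z) (real n) \<partial>M) \<longlonglongrightarrow> L g" by simp
    have int: "integrable M (\<lambda>z. min (g z) (real n))" for n
      by (rule integrable_const_bound[of _ "real n"]) (use g0 spM in \<open>auto intro!: meas mB\<close>)
    have mono: "AE z in M. mono (\<lambda>n. min (g z) (real n))" by (auto simp: mono_def min_le_iff_disj)
    have lim: "AE z in M. (\<lambda>n. min (g z) (real n)) \<longlonglongrightarrow> g z"
    proof (intro AE_I2)
      fix z
      have "\<forall>\<^sub>F n in sequentially. min (g z) (real n) = g z"
        using eventually_ge_at_top[of "nat \<lceil>g z\<rceil>"]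
        by eventually_elim (auto simp: min_def intro: real_nat_ceiling_ge[THEN order_trans])
      then show "(\<lambda>n. min (g z) (real n)) \<longlonglongrightarrow> g z" by (rule tendsto_eventually)
    qed
    show ?thesis
      using integrable_monotone_convergence[OF int mono lim Ilim meas[OF g]]
        integral_monotone_convergence[OF int mono lim Ilim meas[OF g]] by simp
  qed
  have all: "integrable M g \<and> integral\<^sup>L M g = L g" if g: "g \<in> B" for g
  proof -
    let ?p = "\<lambda>z. max 0 (g z)" and ?m = "\<lambda>z. max 0 (- g z)"
    have B: "?p \<in> B" "?m \<in> B" using max[OF const g] max[OF const scale[OF g, of "-1"]] by auto
    have eq: "g = (\<lambda>z. ?p z - ?m z)" by auto
    have *: "integrable M ?p" "integral\<^sup>L M ?p = L ?p" "integrable M ?m" "integral\<^sup>L M ?m = L ?m"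
      using nonneg B by auto
    show ?thesis
      by (subst (1 2 3) eq) (use * L_diff[OF B] in auto)
  qed
  show thesis by (rule that[of M]) (use spM all in auto)
qed

end

section \<open>Semicontinuous costs and their expectation\<close>

text \<open>Points where \<open>g N\<close> stays above \<open>e\<close> accumulate at some
  \<open>l\<close>. An index \<open>m\<close> with \<open>g m l < e\<close> is fixed first;
  monotonicity in the index carries the lower bound \<open>e\<close> to \<open>g m\<close> along the
  subsequence, contradicting continuity at \<open>l\<close>.\<close>

lemma Dini_decreasing_to_zero:
  fixes g :: "nat \<Rightarrow> 'a::metric_space \<Rightarrow> real"
  assumes K: "compact K" and cont: "\<And>n. continuous_on K (g n)"
    and dec: "\<And>x n. x \<in> K \<Longrightarrow> g (Suc n) x \<le> g n x"
    and lim: "\<And>x. x \<in> K \<Longrightarrow> (\<lambda>n. g n x) \<longlonglongrightarrow> 0" and e: "0 < e"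
  obtains N where "\<And>n x. N \<le> n \<Longrightarrow> x \<in> K \<Longrightarrow> g n x < e"
proof -
  have anti: "g n x \<le> g m x" if "m \<le> n" "x \<in> K" for m n x
    using lift_Suc_antimono_le[of "\<lambda>n. g n x", OF dec[OF that(2)] that(1)] .
  have "\<exists>N. \<forall>x\<in>K. g N x < e"
  proof (rule ccontr)
    assume "\<not> ?thesis"
    then have "\<forall>N. \<exists>x. x \<in> K \<and> e \<le> g N x" by (auto simp: not_less)
    then obtain x where x: "\<And>N. x N \<in> K" "\<And>N. e \<le> g N (x N)" by metis
    obtain l r where l: "l \<in> K" "strict_mono r" "(x \<circ> r) \<longlonglongrightarrow> l"
      using K x(1) unfolding compact_def by blast
    have "\<forall>\<^sub>F m in sequentially. g m l < e"
      using order_tendstoD(2)[OF lim[OF l(1)] e] .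
    then obtain m where m: "g m l < e"
      using eventually_happens by fastforce
    have "(\<lambda>k. g m ((x \<circ> r) k)) \<longlonglongrightarrow> g m l"
      using continuous_on_tendsto_compose[OF cont l(3,1)] x(1) by auto
    moreover have "\<forall>\<^sub>F k in sequentially. e \<le> g m ((x \<circ> r) k)"
      using eventually_ge_at_top[of m]
    proof eventually_elim
      case (elim k)
      then have "m \<le> r k" using seq_suble[OF l(2), of k] by linarith
      then show ?case using x(2)[of "r k"] anti[OF _ x(1)] by (auto intro: order_trans)
    qed
    ultimately have "e \<le> g m l" by (rule tendsto_lowerbound) simp
    then show False using m by simp
  qed
  then obtain N where "\<forall>x\<in>K. g N x < e" by blast
  then show thesis using that[of N] anti by (meson le_less_trans)
qed

text \<open>The approximants are the inf-convolutions of the truncations with multiples of the distance.\<close>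

lemma lsc_approx_from_below:
  fixes X :: "'a::metric_space set" and c :: "'a \<Rightarrow> ereal"
  assumes lsc: "\<And>a. openin (top_of_set X) {x \<in> X. a < c x}" and pos: "\<And>x. x \<in> X \<Longrightarrow> 0 \<le> c x"
  shows "\<exists>h. (\<forall>m. continuous_on X (h m)) \<and>
    (\<forall>m. \<forall>x\<in>X. 0 \<le> h m x \<and> h m x \<le> real m \<and> h m x \<le> h (Suc m) x \<and> ereal (h m x) \<le> c x) \<and>
    (\<forall>x\<in>X. (SUP m. ereal (h m x)) = c x)"
proof (cases "X = {}")
  case False
  \<comment> \<open>Truncating at \<open>m\<close> makes the values real, so that the infimum below
    is a real number, and bounds \<open>h m\<close> by \<open>m\<close>.\<close>
  define b where "b m y = real_of_ereal (min (c y) (ereal (real m)))" for m y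
  have b: "ereal (b m y) = min (c y) (ereal (real m))" if "y \<in> X" for m y
    using pos[OF that] unfolding b_def by (intro ereal_real') (cases "c y", auto simp: min_def)
  have b0: "0 \<le> b m y" if "y \<in> X" for m y
    using b[OF that, of m] pos[OF that] by (metis ereal_less_eq(5) min.bounded_iff of_nat_0_le_iff)
  have bm: "b m y \<le> real m" if "y \<in> X" for m y
    using b[OF that, of m] by (metis ereal_less_eq(3) min.cobounded2)
  have bS: "b m y \<le> b (Suc m) y" if "y \<in> X" for m y
  proof -
    have "ereal (b m y) \<le> ereal (b (Suc m) y)"
      unfolding b[OF that] by (intro min.mono) auto
    then show ?thesis by simp
  qed
  define F where "F m x y = b m y + real m * dist x y" for m x y
  define h where "h m x = (INF y\<in>X. F m x y)" for m x
  have F0: "0 \<le> F m x y" if "y \<in> X" for m x y using b0[OF that] by (simp add: F_def)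
  have bdd: "bdd_below (F m x ` X)" for m x
    using F0 by (intro bdd_belowI2[where m=0]) auto
  have h_le: "h m x \<le> F m x y" if "y \<in> X" for m x y
    unfolding h_def by (rule cINF_lower[OF bdd that])
  have h_ge: "a \<le> h m x" if "\<And>y. y \<in> X \<Longrightarrow> a \<le> F m x y" for a m x
    unfolding h_def using that False by (intro cINF_greatest) auto
  have h_b: "h m x \<le> b m x" if "x \<in> X" for m x
    using h_le[OF that, of m x] by (simp add: F_def)
  have lip: "h m x \<le> h m x' + real m * dist x x'" for m x x'
  proof -
    have "h m x - real m * dist x x' \<le> h m x'"
    proof (rule h_ge)
      fix y assume y: "y \<in> X"
      have "h m x \<le> b m y + real m * dist x y" using h_le[OF y] by (simp add: F_def)
      also have "\<dots> \<le> b m y + real m * (dist x x' + dist x' y)"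
        by (intro add_left_mono mult_left_mono dist_triangle) auto
      finally show "h m x - real m * dist x x' \<le> F m x' y"
        by (simp add: F_def algebra_simps)
    qed
    then show ?thesis by simp
  qed
  have cont: "continuous_on X (h m)" for m
  proof -
    have "(real m)-lipschitz_on X (h m)"
    proof (rule lipschitz_onI)
      fix x y
      show "dist (h m x) (h m y) \<le> real m * dist x y"
        using lip[of m x y] lip[of m y x] by (auto simp: dist_real_def dist_commute abs_le_iff)
    qed simp
    then show ?thesis by (rule lipschitz_on_continuous_on)
  qed
  have mono: "h m x \<le> h (Suc m) x" if "x \<in> X" for m x
  proof (rule h_ge)
    fix y assume y: "y \<in> X"
    have "h m x \<le> F m x y" by (rule h_le[OF y])
    also have "\<dots> \<le> F (Suc m) x y"
      unfolding F_def using bS[OF y, of m] by (intro add_mono mult_right_mono) auto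
    finally show "h m x \<le> F (Suc m) x y" .
  qed
  have h_c: "ereal (h m x) \<le> c x" if "x \<in> X" for m x
  proof -
    have "ereal (h m x) \<le> ereal (b m x)" using h_b[OF that] by simp
    also have "\<dots> \<le> c x" unfolding b[OF that] by simp
    finally show ?thesis .
  qed
  have sup: "(SUP m. ereal (h m x)) = c x" if x: "x \<in> X" for x
  proof (rule antisym)
    show "(SUP m. ereal (h m x)) \<le> c x" using h_c[OF x] by (intro SUP_least)
    show "c x \<le> (SUP m. ereal (h m x))"
    proof (rule dense_le)
      fix a' assume "a' < c x"
      show "a' \<le> (SUP m. ereal (h m x))"
      proof (cases "a' \<le> 0")
        case True
        have "a' \<le> ereal (h 0 x)" using True h_ge[of 0 0 x] F0 by (metis ereal_less_eq(5) order_trans)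
        then show ?thesis by (rule SUP_upper2[OF UNIV_I])
      next
        case False
        then obtain a where a: "a' = ereal a" "a > 0"
          using \<open>a' < c x\<close> by (cases a') auto
        obtain U where U: "open U" "{x \<in> X. ereal a < c x} = X \<inter> U"
          using lsc[of "ereal a"] by (auto simp: openin_open)
        have "x \<in> U" using U(2) x \<open>a' < c x\<close> a by auto
        then obtain d where d: "d > 0" "ball x d \<subseteq> U" using U(1) openE by blast
        \<comment> \<open>\<open>m > a\<close> keeps the truncation above \<open>a\<close> inside
          the ball, and \<open>m > a / d\<close> makes the distance penalty alone exceed
          \<open>a\<close> outside it.\<close>
        obtain m where m: "max a (a / d) < real m" using reals_Archimedean2 by blast
        have "a \<le> h m x"
        proof (rule h_ge)
          fix y assume y: "y \<in> X"
          show "a \<le> F m x y"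
          proof (cases "dist x y < d")
            case True
            then have "ereal a < c y" using U(2) d(2) y by auto
            then have "ereal a \<le> ereal (b m y)" unfolding b[OF y] using m by auto
            then show ?thesis by (simp add: F_def add_increasing2)
          next
            case False
            have "a \<le> real m * d" using m d(1) by (simp add: field_simps)
            also have "\<dots> \<le> real m * dist x y" using False by (intro mult_left_mono) auto
            finally show ?thesis using b0[OF y, of m] by (simp add: F_def)
          qed
        qed
        then have "a' \<le> ereal (h m x)" using a by simp
        then show ?thesis by (rule SUP_upper2[OF UNIV_I])
      qed
    qed
  qed
  have "0 \<le> h m x" for m x using h_ge[of 0 m x] F0 by auto
  moreover have "h m x \<le> real m" if "x \<in> X" for m x using h_b[OF that, of m] bm[OF that, of m] by linarith
  ultimately show ?thesis using cont mono h_c sup by (intro exI[of _ h]) auto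
qed auto

text \<open>Adding an integrable \<open>w\<close> that makes \<open>c\<close> nonnegative replaces
  the difference of two extended integrals by a single nonnegative one, to which monotone
  convergence applies. The negative part is dominated by \<open>w\<close>, so
  \<open>\<infinity> - \<infinity>\<close> cannot occur.\<close>

lemma ereal_expect_shift:
  fixes c :: "'a \<Rightarrow> ereal" and w :: "'a \<Rightarrow> real"
  assumes c [measurable]: "(\<lambda>x. if x \<in> A then c x else 0) \<in> borel_measurable Q"
    and w: "integrable Q w" "\<And>x. 0 \<le> w x"
    and cw: "\<And>x. x \<in> A \<Longrightarrow> ereal (- w x) \<le> c x"
  shows "ereal_expect Q A c = enn2ereal (\<integral>\<^sup>+ x. e2ennreal ((if x \<in> A then c x else 0) + ereal (w x)) \<partial>Q)
      - ereal (\<integral>x. w x \<partial>Q)"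
proof -
  define c' where "c' x = (if x \<in> A then c x else 0)" for x
  have c'm [measurable]: "c' \<in> borel_measurable Q" using c unfolding c'_def .
  have wm [measurable]: "w \<in> borel_measurable Q" using w(1) by auto
  have c'w: "ereal (- w x) \<le> c' x" for x using cw w(2)[of x] by (auto simp: c'_def)
  \<comment> \<open>Positive part plus \<open>w\<close> equals \<open>c + w\<close> plus negative
    part; the additive form avoids truncated subtraction in \<open>ennreal\<close>.\<close>
  have pt: "e2ennreal (c' x) + ennreal (w x) = e2ennreal (c' x + ereal (w x)) + e2ennreal (- c' x)" for x
  proof (cases "c' x")
    case (real r)
    then have r: "- w x \<le> r" using c'w[of x] by simp
    show ?thesis
    proof (cases "0 \<le> r")
      case True
      then show ?thesis using real w(2)[of x] by (simp add: e2ennreal_ereal ennreal_neg)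
    next
      case False
      then show ?thesis using real r
        by (simp add: e2ennreal_ereal ennreal_neg ennreal_plus[symmetric] del: ennreal_plus)
    qed
  next
    case PInf then show ?thesis by simp
  next
    case MInf then show ?thesis using c'w[of x] by simp
  qed
  define P where "P = (\<integral>\<^sup>+ x. e2ennreal (c' x) \<partial>Q)"
  define M where "M = (\<integral>\<^sup>+ x. e2ennreal (- c' x) \<partial>Q)"
  define R where "R = (\<integral>\<^sup>+ x. e2ennreal (c' x + ereal (w x)) \<partial>Q)"
  have W: "(\<integral>\<^sup>+ x. ennreal (w x) \<partial>Q) = ennreal (\<integral>x. w x \<partial>Q)"
    using w by (intro nn_integral_eq_integral) auto
  have "P + ennreal (\<integral>x. w x \<partial>Q) = (\<integral>\<^sup>+ x. e2ennreal (c' x) + ennreal (w x) \<partial>Q)"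
    unfolding P_def W[symmetric] by (intro nn_integral_add[symmetric]) measurable
  also have "\<dots> = R + M"
    unfolding R_def M_def pt by (intro nn_integral_add) measurable
  finally have eq: "P + ennreal (\<integral>x. w x \<partial>Q) = R + M" .
  have "M \<le> ennreal (\<integral>x. w x \<partial>Q)"
    unfolding M_def W[symmetric]
  proof (intro nn_integral_mono)
    fix x
    have "- c' x \<le> ereal (w x)" using c'w[of x] by (metis ereal_uminus_le_reorder uminus_ereal.simps(1))
    then show "e2ennreal (- c' x) \<le> ennreal (w x)" by (metis e2ennreal_ereal e2ennreal_mono)
  qed
  then obtain m where m: "M = ennreal m" "0 \<le> m"
    by (metis ennreal_cases ennreal_neq_top infinity_ennreal_def top.extremum_uniqueI)
  have w0: "0 \<le> (\<integral>x. w x \<partial>Q)" using w(2) by simp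
  have "enn2ereal P - enn2ereal M = enn2ereal R - ereal (\<integral>x. w x \<partial>Q)"
  proof (cases P)
    case (real p)
    show ?thesis
    proof (cases R)
      case (real r)
      have "p + (\<integral>x. w x \<partial>Q) = r + m"
        using eq m w0 real \<open>P = ennreal p\<close> \<open>0 \<le> p\<close>
        by (simp add: ennreal_plus[symmetric] del: ennreal_plus)
      then show ?thesis using m real \<open>P = ennreal p\<close> \<open>0 \<le> p\<close> by (simp add: enn2ereal_ennreal)
    next
      case top
      then show ?thesis using eq m real by (simp add: ennreal_plus[symmetric] w0 del: ennreal_plus)
    qed
  next
    case top
    then have "R = top" using eq m by (cases R) (auto simp: ennreal_plus[symmetric] top_unique simp del: ennreal_plus)
    then show ?thesis using top m by (simp add: enn2ereal_ennreal)
  qed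
  then show ?thesis unfolding ereal_expect_def P_def M_def R_def c'_def by simp
qed

lemma set_integral_le_ereal_expect:
  fixes c :: "'a \<Rightarrow> ereal" and g w :: "'a \<Rightarrow> real"
  assumes c: "(\<lambda>x. if x \<in> A then c x else 0) \<in> borel_measurable Q"
    and w: "integrable Q w" "\<And>x. 0 \<le> w x"
    and cw: "\<And>x. x \<in> A \<Longrightarrow> ereal (- w x) \<le> c x"
    and g: "set_integrable Q A g" "\<And>x. x \<in> A \<Longrightarrow> ereal (g x) \<le> c x"
  shows "ereal (LINT x:A|Q. g x) \<le> ereal_expect Q A c"
proof -
  define g' where "g' x = indicator A x *\<^sub>R g x" for x
  \<comment> \<open>The shift has to make both \<open>c\<close> and \<open>g\<close> nonnegative, so
    \<open>w\<close> alone is not enough.\<close>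
  define v where "v x = w x + \<bar>g' x\<bar>" for x
  have g'i: "integrable Q g'" using g(1) unfolding set_integrable_def g'_def .
  have v: "integrable Q v" "\<And>x. 0 \<le> v x" using w g'i by (auto simp: v_def[abs_def])
  have le: "ennreal (g' x + v x) \<le> e2ennreal ((if x \<in> A then c x else 0) + ereal (v x))" for x
  proof -
    have "ereal (g' x + v x) \<le> (if x \<in> A then c x else 0) + ereal (v x)"
      unfolding plus_ereal.simps(1)[symmetric] using g(2) by (intro add_right_mono) (auto simp: g'_def)
    then show ?thesis by (metis e2ennreal_ereal e2ennreal_mono)
  qed
  have gv: "0 \<le> g' x + v x" for x using w(2)[of x] by (simp add: v_def)
  have "ennreal (\<integral>x. g' x + v x \<partial>Q) = (\<integral>\<^sup>+ x. ennreal (g' x + v x) \<partial>Q)"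
    using v g'i gv by (intro nn_integral_eq_integral[symmetric]) auto
  also have "\<dots> \<le> (\<integral>\<^sup>+ x. e2ennreal ((if x \<in> A then c x else 0) + ereal (v x)) \<partial>Q)"
    using le by (rule nn_integral_mono)
  finally have "ereal (\<integral>x. g' x + v x \<partial>Q)
      \<le> enn2ereal (\<integral>\<^sup>+ x. e2ennreal ((if x \<in> A then c x else 0) + ereal (v x)) \<partial>Q)"
    using gv by (simp add: less_eq_ennreal.rep_eq enn2ereal_ennreal)
  then have "ereal (\<integral>x. g' x + v x \<partial>Q) - ereal (\<integral>x. v x \<partial>Q)
      \<le> enn2ereal (\<integral>\<^sup>+ x. e2ennreal ((if x \<in> A then c x else 0) + ereal (v x)) \<partial>Q) - ereal (\<integral>x. v x \<partial>Q)"
    by (rule ereal_minus_mono) simp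
  also have "\<dots> = ereal_expect Q A c"
  proof (rule ereal_expect_shift[OF c v, symmetric])
    fix x assume "x \<in> A"
    have "ereal (- v x) \<le> ereal (- w x)" by (simp add: v_def)
    then show "ereal (- v x) \<le> c x" using cw[OF \<open>x \<in> A\<close>] by (rule order_trans)
  qed
  finally have "ereal (\<integral>x. g' x + v x \<partial>Q) - ereal (\<integral>x. v x \<partial>Q) \<le> ereal_expect Q A c" .
  then show ?thesis using g'i v by (simp add: set_lebesgue_integral_def g'_def[abs_def])
qed

text \<open>This is monotone convergence for \<open>c + w\<close>; the shift by \<open>w\<close> is
  then undone on both sides.\<close>

lemma ereal_expect_le_of_approx:
  fixes c :: "'a \<Rightarrow> ereal" and h :: "nat \<Rightarrow> 'a \<Rightarrow> real" and w :: "'a \<Rightarrow> real"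
  assumes w: "integrable Q w" "\<And>x. 0 \<le> w x"
    and cw: "\<And>x. x \<in> A \<Longrightarrow> ereal (- w x) \<le> c x"
    and h: "\<And>m. integrable Q (h m)" "\<And>m x. 0 \<le> h m x" "\<And>m x. h m x \<le> h (Suc m) x"
      "\<And>x. (SUP m. ereal (h m x)) = (if x \<in> A then c x else 0) + ereal (w x)"
    and R: "\<And>m. (\<integral>x. h m x \<partial>Q) - (\<integral>x. w x \<partial>Q) \<le> R"
  shows "ereal_expect Q A c \<le> ereal R"
proof -
  define c' where "c' x = (if x \<in> A then c x else 0)" for x
  have hm: "h m \<in> borel_measurable Q" for m using h(1) by auto
  \<comment> \<open>Measurability of \<open>c\<close> is recovered from the approximants: it is
    their supremum minus \<open>w\<close>.\<close>
  have cm: "c' \<in> borel_measurable Q"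
  proof -
    have "c' = (\<lambda>x. (SUP m. ereal (h m x)) - ereal (w x))"
      unfolding h(4) c'_def by (auto simp: ereal_add_diff_cancel fun_eq_iff)
    also have "\<dots> \<in> borel_measurable Q" using hm w(1) by measurable
    finally show ?thesis .
  qed
  have e: "e2ennreal (c' x + ereal (w x)) = (SUP m. ennreal (h m x))" for x
  proof -
    have "e2ennreal (c' x + ereal (w x)) = (SUP m. e2ennreal (ereal (h m x)))"
      unfolding c'_def h(4)[symmetric]
      by (intro sup_continuousD[OF sup_continuous_e2ennreal[OF sup_continuous_id], unfolded id_def] monoI)
         (auto intro: lift_Suc_mono_le[of "\<lambda>m. h m x"] h(3))
    then show ?thesis by (simp add: e2ennreal_ereal)
  qed
  have "(\<integral>\<^sup>+ x. e2ennreal (c' x + ereal (w x)) \<partial>Q) = (SUP m. \<integral>\<^sup>+ x. ennreal (h m x) \<partial>Q)"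
    unfolding e by (intro nn_integral_monotone_convergence_SUP incseq_SucI le_funI ennreal_leI h(3)) (use hm in measurable)
  also have "\<dots> = (SUP m. ennreal (\<integral>x. h m x \<partial>Q))"
    using h by (intro SUP_cong nn_integral_eq_integral) auto
  also have "\<dots> \<le> ennreal (R + (\<integral>x. w x \<partial>Q))"
    using R by (intro SUP_least ennreal_leI) (simp add: algebra_simps)
  finally have "enn2ereal (\<integral>\<^sup>+ x. e2ennreal (c' x + ereal (w x)) \<partial>Q) \<le> ereal (R + (\<integral>x. w x \<partial>Q))"
  proof -
    assume le: "(\<integral>\<^sup>+ x. e2ennreal (c' x + ereal (w x)) \<partial>Q) \<le> ennreal (R + (\<integral>x. w x \<partial>Q))"
    have "0 \<le> (\<integral>x. h 0 x \<partial>Q)" using h(2) by simp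
    then have "0 \<le> R + (\<integral>x. w x \<partial>Q)" using R[of 0] by linarith
    then show ?thesis using le by (simp add: less_eq_ennreal.rep_eq enn2ereal_ennreal)
  qed
  then have "enn2ereal (\<integral>\<^sup>+ x. e2ennreal (c' x + ereal (w x)) \<partial>Q) - ereal (\<integral>x. w x \<partial>Q)
      \<le> ereal (R + (\<integral>x. w x \<partial>Q)) - ereal (\<integral>x. w x \<partial>Q)"
    by (intro ereal_minus_mono) auto
  then show ?thesis
    using ereal_expect_shift[OF cm[unfolded c'_def] w cw] by (simp add: c'_def)
qed

lemma sum_ereal_not_MInf:
  fixes f :: "'a \<Rightarrow> ereal"
  assumes "finite I" "\<And>i. i \<in> I \<Longrightarrow> f i \<noteq> - \<infinity>"
  shows "sum f I \<noteq> - \<infinity>"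
  using assms by (induction I rule: finite_induct) auto

text \<open>The components can be chosen independently, so a bound on all sums bounds the sum of
  suprema. It serves to pass from families \<open>\<phi>\<close> to the sum of the penalties.
  Nonempty \<open>E i\<close> exclude the value \<open>- \<infinity>\<close>, which extended
  addition would not handle well.\<close>

lemma sum_SUP_le:
  fixes a :: "'i \<Rightarrow> 'b \<Rightarrow> real"
  assumes "finite I" "\<And>i. i \<in> I \<Longrightarrow> E i \<noteq> {}"
    and "\<And>\<phi>. (\<And>i. i \<in> I \<Longrightarrow> \<phi> i \<in> E i) \<Longrightarrow> (\<Sum>i\<in>I. a i (\<phi> i)) \<le> R"
  shows "(\<Sum>i\<in>I. SUP e\<in>E i. ereal (a i e)) \<le> ereal R"
  using assms
proof (induction I arbitrary: R rule: finite_induct)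
  case empty
  then show ?case by (simp add: zero_ereal_def)
next
  case (insert i I)
  let ?S = "\<Sum>i\<in>I. SUP e\<in>E i. ereal (a i e)"
  have step: "?S \<le> ereal (R - a i e)" if e: "e \<in> E i" for e
  proof (rule insert.IH)
    fix \<phi> assume \<phi>: "\<And>j. j \<in> I \<Longrightarrow> \<phi> j \<in> E j"
    have "(\<Sum>j\<in>insert i I. a j ((\<phi>(i := e)) j)) \<le> R"
      by (rule insert.prems(2)) (use \<phi> e in auto)
    also have "(\<Sum>j\<in>insert i I. a j ((\<phi>(i := e)) j)) = a i e + (\<Sum>j\<in>I. a j (\<phi> j))"
      using insert.hyps by (subst sum.insert) (auto intro!: sum.cong)
    finally show "(\<Sum>j\<in>I. a j (\<phi> j)) \<le> R - a i e" by simp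
  qed (use insert.prems in auto)
  have "(SUP e\<in>E i. ereal (a i e)) + ?S \<le> ereal R"
  proof (cases "?S = - \<infinity>")
    case True
    have "(SUP e\<in>E j. ereal (a j e)) \<noteq> - \<infinity>" if j: "j \<in> I" for j
    proof -
      have "E j \<noteq> {}" using insert.prems(1) j by blast
      then obtain e where "e \<in> E j" by blast
      then have "ereal (a j e) \<le> (SUP e\<in>E j. ereal (a j e))" by (rule SUP_upper)
      then show ?thesis by auto
    qed
    then have "?S \<noteq> - \<infinity>" by (intro sum_ereal_not_MInf insert.hyps(1))
    then show ?thesis using True by simp
  next
    case False
    obtain e0 where "e0 \<in> E i" using insert.prems(1) by blast
    then obtain s where s: "?S = ereal s" using False step[of e0] by (cases ?S) auto
    have "(SUP e\<in>E i. ereal (a i e)) \<le> ereal (R - s)"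
      using step s by (intro SUP_least) (auto simp: algebra_simps)
    then have "(SUP e\<in>E i. ereal (a i e)) + ?S \<le> ereal (R - s) + ereal s"
      unfolding s by (rule add_right_mono)
    then show ?thesis by simp
  qed
  then show ?case using insert.hyps by simp
qed

section \<open>Functions of linear growth on the path space\<close>

definition weight :: "nat \<Rightarrow> (nat \<Rightarrow> real^'d::finite) \<Rightarrow> real" where
  "weight T x = 1 + (\<Sum>t\<le>T. \<Sum>j\<in>UNIV. \<bar>x t $ j\<bar>)"

text \<open>Continuity and growth are asked on \<open>Omega\<close> only, values elsewhere being
  free. The space contains the coordinates, so a measure integrating all of it has first
  moments.\<close>

definition lin_growth :: "nat \<Rightarrow> (nat \<Rightarrow> 'd::finite \<Rightarrow> real set) \<Rightarrow> ((nat \<Rightarrow> real^'d) \<Rightarrow> real) set" where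
  "lin_growth T Kc = {g. continuous_on (Omega T Kc) g \<and>
      (\<exists>C. \<forall>x\<in>Omega T Kc. \<bar>g x\<bar> \<le> C * weight T x)}"

lemma weight_ge_1: "1 \<le> weight T x"
  unfolding weight_def by (simp add: sum_nonneg)

lemma continuous_on_coord [continuous_intros]: "continuous_on S (\<lambda>x::nat \<Rightarrow> real^'d. x t)"
  by (rule continuous_on_subset[OF continuous_on_product_coordinates]) simp

lemma continuous_on_weight: "continuous_on S (weight T)"
  unfolding weight_def[abs_def] by (intro continuous_intros)

lemma lin_growthI:
  assumes "continuous_on (Omega T Kc) g" "\<And>x. x \<in> Omega T Kc \<Longrightarrow> \<bar>g x\<bar> \<le> C * weight T x"
  shows "g \<in> lin_growth T Kc"
  using assms unfolding lin_growth_def by blast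

lemma lin_growthE:
  assumes "g \<in> lin_growth T Kc"
  obtains C where "0 \<le> C" "continuous_on (Omega T Kc) g" "\<And>x. x \<in> Omega T Kc \<Longrightarrow> \<bar>g x\<bar> \<le> C * weight T x"
proof -
  obtain C where C: "continuous_on (Omega T Kc) g" "\<And>x. x \<in> Omega T Kc \<Longrightarrow> \<bar>g x\<bar> \<le> C * weight T x"
    using assms unfolding lin_growth_def by blast
  have "\<bar>g x\<bar> \<le> \<bar>C\<bar> * weight T x" if "x \<in> Omega T Kc" for x
  proof -
    have "C * weight T x \<le> \<bar>C\<bar> * weight T x"
      using weight_ge_1[of T x] by (intro mult_right_mono) auto
    then show ?thesis using C(2)[OF that] by linarith
  qed
  then show thesis using that[of "\<bar>C\<bar>"] C(1) by auto
qed

lemma lin_growth_lin: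
  assumes "g \<in> lin_growth T Kc" "h \<in> lin_growth T Kc"
  shows "(\<lambda>x. a * g x + b * h x) \<in> lin_growth T Kc"
proof -
  obtain C where C: "continuous_on (Omega T Kc) g" "\<And>x. x \<in> Omega T Kc \<Longrightarrow> \<bar>g x\<bar> \<le> C * weight T x"
    using lin_growthE[OF assms(1)] by metis
  obtain D where D: "continuous_on (Omega T Kc) h" "\<And>x. x \<in> Omega T Kc \<Longrightarrow> \<bar>h x\<bar> \<le> D * weight T x"
    using lin_growthE[OF assms(2)] by metis
  show ?thesis
  proof (rule lin_growthI)
    show "continuous_on (Omega T Kc) (\<lambda>x. a * g x + b * h x)" by (intro continuous_intros C D)
    fix x assume x: "x \<in> Omega T Kc"
    have "\<bar>a * g x + b * h x\<bar> \<le> \<bar>a\<bar> * \<bar>g x\<bar> + \<bar>b\<bar> * \<bar>h x\<bar>"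
      by (metis abs_mult abs_triangle_ineq)
    also have "\<dots> \<le> \<bar>a\<bar> * (C * weight T x) + \<bar>b\<bar> * (D * weight T x)"
      using C(2)[OF x] D(2)[OF x] by (intro add_mono mult_left_mono) auto
    finally show "\<bar>a * g x + b * h x\<bar> \<le> (\<bar>a\<bar> * C + \<bar>b\<bar> * D) * weight T x"
      by (simp add: algebra_simps)
  qed
qed

lemma lin_growth_weight: "weight T \<in> lin_growth T Kc"
proof (rule lin_growthI[where C=1])
  show "\<bar>weight T x\<bar> \<le> 1 * weight T x" for x :: "nat \<Rightarrow> real^'a"
    using weight_ge_1[of T x] by simp
qed (rule continuous_on_weight)

lemma lin_growth_const: "(\<lambda>x. k) \<in> lin_growth T Kc"
proof (rule lin_growthI[where C="\<bar>k\<bar>"])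
  show "\<bar>k\<bar> \<le> \<bar>k\<bar> * weight T x" for x :: "nat \<Rightarrow> real^'a"
    using mult_left_mono[OF weight_ge_1[of T x], of "\<bar>k\<bar>"] by simp
qed simp

lemma lin_growth_add: "g \<in> lin_growth T Kc \<Longrightarrow> h \<in> lin_growth T Kc \<Longrightarrow> (\<lambda>x. g x + h x) \<in> lin_growth T Kc"
  using lin_growth_lin[of g T Kc h 1 1] by simp

lemma lin_growth_diff: "g \<in> lin_growth T Kc \<Longrightarrow> h \<in> lin_growth T Kc \<Longrightarrow> (\<lambda>x. g x - h x) \<in> lin_growth T Kc"
  using lin_growth_lin[of g T Kc h 1 "-1"] by simp

lemma lin_growth_scale: "g \<in> lin_growth T Kc \<Longrightarrow> (\<lambda>x. a * g x) \<in> lin_growth T Kc"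
  using lin_growth_lin[of g T Kc g a 0] by simp

lemma lin_growth_sum:
  "(\<And>i. i \<in> I \<Longrightarrow> g i \<in> lin_growth T Kc) \<Longrightarrow> (\<lambda>x. \<Sum>i\<in>I. g i x) \<in> lin_growth T Kc"
  by (induction I rule: infinite_finite_induct) (auto intro: lin_growth_const lin_growth_add)

lemma lin_growth_max:
  assumes "g \<in> lin_growth T Kc" "h \<in> lin_growth T Kc"
  shows "(\<lambda>x. max (g x) (h x)) \<in> lin_growth T Kc"
proof -
  obtain C where C: "0 \<le> C" "continuous_on (Omega T Kc) g" "\<And>x. x \<in> Omega T Kc \<Longrightarrow> \<bar>g x\<bar> \<le> C * weight T x"
    using lin_growthE[OF assms(1)] by metis
  obtain D where D: "0 \<le> D" "continuous_on (Omega T Kc) h" "\<And>x. x \<in> Omega T Kc \<Longrightarrow> \<bar>h x\<bar> \<le> D * weight T x"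
    using lin_growthE[OF assms(2)] by metis
  show ?thesis
  proof (rule lin_growthI)
    show "continuous_on (Omega T Kc) (\<lambda>x. max (g x) (h x))" by (intro continuous_intros C D)
    fix x assume x: "x \<in> Omega T Kc"
    have "0 \<le> C * weight T x" "0 \<le> D * weight T x"
      using C(1) D(1) weight_ge_1[of T x] by auto
    then show "\<bar>max (g x) (h x)\<bar> \<le> (C + D) * weight T x"
      using C(3)[OF x] D(3)[OF x] by (auto simp: max_def algebra_simps)
  qed
qed

lemma lin_growth_cong:
  "g \<in> lin_growth T Kc \<Longrightarrow> (\<And>x. x \<in> Omega T Kc \<Longrightarrow> g x = h x) \<Longrightarrow> h \<in> lin_growth T Kc"
  unfolding lin_growth_def by (auto cong: continuous_on_cong_simp)

lemma OmegaD: "x \<in> Omega T Kc \<Longrightarrow> t \<le> T \<Longrightarrow> x t \<in> Kset Kc t"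
  unfolding Omega_def by auto

lemma coord_sum_le_weight: "t \<le> T \<Longrightarrow> 1 + (\<Sum>j\<in>UNIV. \<bar>x t $ j\<bar>) \<le> weight T x"
  unfolding weight_def by (intro add_left_mono member_le_sum) (auto intro: sum_nonneg)

lemma lin_growth_Ct:
  assumes "\<phi> \<in> Ct Kc t" "t \<le> T"
  shows "(\<lambda>x. \<phi> (x t)) \<in> lin_growth T Kc"
proof -
  obtain C where C: "continuous_on (Kset Kc t) \<phi>"
      "\<And>y. y \<in> Kset Kc t \<Longrightarrow> \<bar>\<phi> y\<bar> \<le> C * (1 + (\<Sum>j\<in>UNIV. \<bar>y $ j\<bar>))"
    using assms(1) unfolding Ct_def by blast
  show ?thesis
  proof (rule lin_growthI)
    show "continuous_on (Omega T Kc) (\<lambda>x. \<phi> (x t))"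
      by (rule continuous_on_compose2[OF C(1) continuous_on_coord]) (auto dest: OmegaD[OF _ assms(2)])
    fix x assume x: "x \<in> Omega T Kc"
    let ?s = "1 + (\<Sum>j\<in>UNIV. \<bar>x t $ j\<bar>)"
    have "\<bar>\<phi> (x t)\<bar> \<le> C * ?s" by (rule C(2)[OF OmegaD[OF x assms(2)]])
    also have "\<dots> \<le> \<bar>C\<bar> * ?s" by (intro mult_right_mono) (auto intro: add_nonneg_nonneg sum_nonneg)
    also have "\<dots> \<le> \<bar>C\<bar> * weight T x" by (intro mult_left_mono coord_sum_le_weight assms) auto
    finally show "\<bar>\<phi> (x t)\<bar> \<le> \<bar>C\<bar> * weight T x" .
  qed
qed

lemma lin_growth_coord:
  assumes "t \<le> T"
  shows "(\<lambda>x. x t $ j) \<in> lin_growth T Kc"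
proof (rule lin_growthI[where C=1])
  show "continuous_on (Omega T Kc) (\<lambda>x. x t $ j)" by (intro continuous_intros)
  fix x :: "nat \<Rightarrow> real^'a"
  have "\<bar>x t $ j\<bar> \<le> (\<Sum>j\<in>UNIV. \<bar>x t $ j\<bar>)" by (rule member_le_sum) auto
  then show "\<bar>x t $ j\<bar> \<le> 1 * weight T x" using coord_sum_le_weight[OF assms, of x] by simp
qed

lemma restrict_Omega: "x \<in> Omega T Kc \<Longrightarrow> t \<le> T \<Longrightarrow> restrict x {0..t} \<in> PiE {0..t} (Kset Kc)"
  unfolding Omega_def by auto

lemma continuous_on_restrict_path:
  "continuous_on S (\<lambda>x::nat \<Rightarrow> real^'d. restrict x {0..t})"
proof (rule continuous_on_coordinatewise_then_product)
  fix i
  show "continuous_on S (\<lambda>x::nat \<Rightarrow> real^'d. restrict x {0..t} i)"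
    by (cases "i \<in> {0..t}") (auto intro: continuous_intros)
qed

text \<open>A bounded strategy times an increment of linear growth has linear growth; continuity
  passes through the restriction of a path to its past.\<close>

lemma lin_growth_Idelta:
  assumes \<Delta>: "\<Delta> \<in> Hstrat T Kc"
  shows "Idelta T \<Delta> \<in> lin_growth T Kc"
proof -
  have "(\<lambda>x. (\<Delta> t (restrict x {0..t})) $ j * (x (Suc t) $ j - x t $ j)) \<in> lin_growth T Kc"
    if t: "t < T" for t j
  proof -
    have c: "continuous_on (PiE {0..t} (Kset Kc)) (\<Delta> t)" and b: "bounded (\<Delta> t ` PiE {0..t} (Kset Kc))"
      using \<Delta> t unfolding Hstrat_def by auto
    obtain D where D: "\<And>y. y \<in> PiE {0..t} (Kset Kc) \<Longrightarrow> norm (\<Delta> t y) \<le> D"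
      using b unfolding bounded_iff by auto
    have "(\<lambda>x. x (Suc t) $ j - x t $ j) \<in> lin_growth T Kc"
      using t by (intro lin_growth_diff lin_growth_coord) auto
    then obtain C where C: "0 \<le> C" "\<And>x. x \<in> Omega T Kc \<Longrightarrow> \<bar>x (Suc t) $ j - x t $ j\<bar> \<le> C * weight T x"
      by (rule lin_growthE) blast
    show ?thesis
    proof (rule lin_growthI)
      have "continuous_on (Omega T Kc) (\<lambda>x. \<Delta> t (restrict x {0..t}))"
        by (rule continuous_on_compose2[OF c continuous_on_restrict_path])
           (use t in \<open>auto intro!: restrict_Omega\<close>)
      then show "continuous_on (Omega T Kc) (\<lambda>x. (\<Delta> t (restrict x {0..t})) $ j * (x (Suc t) $ j - x t $ j))"
        by (intro continuous_intros)
      fix x assume x: "x \<in> Omega T Kc"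
      have "\<bar>\<Delta> t (restrict x {0..t}) $ j\<bar> \<le> \<bar>D\<bar>"
        using component_le_norm_cart[of "\<Delta> t (restrict x {0..t})" j] D[OF restrict_Omega[OF x]] t by fastforce
      then have "\<bar>\<Delta> t (restrict x {0..t}) $ j * (x (Suc t) $ j - x t $ j)\<bar> \<le> \<bar>D\<bar> * (C * weight T x)"
        unfolding abs_mult by (intro mult_mono C(2)[OF x]) auto
      then show "\<bar>\<Delta> t (restrict x {0..t}) $ j * (x (Suc t) $ j - x t $ j)\<bar> \<le> (\<bar>D\<bar> * C) * weight T x"
        by (simp add: mult.assoc)
    qed
  qed
  then show ?thesis
    unfolding Idelta_def[abs_def] by (intro lin_growth_sum) auto
qed

lemma Hstrat_lin:
  assumes "\<Delta> \<in> Hstrat T Kc" "\<Delta>' \<in> Hstrat T Kc"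
  shows "(\<lambda>t y. a *\<^sub>R \<Delta> t y + b *\<^sub>R \<Delta>' t y) \<in> Hstrat T Kc"
  using assms unfolding Hstrat_def
  by (auto intro!: continuous_intros bounded_plus_comp bounded_scaleR_comp)

lemma Hstrat_zero: "(\<lambda>t y. 0) \<in> Hstrat T Kc"
  unfolding Hstrat_def by (auto simp: image_constant_conv)

lemma Idelta_lin:
  "Idelta T (\<lambda>t y. a *\<^sub>R \<Delta> t y + b *\<^sub>R \<Delta>' t y) x = a * Idelta T \<Delta> x + b * Idelta T \<Delta>' x"
  unfolding Idelta_def by (simp add: sum_distrib_left sum.distrib[symmetric] algebra_simps)

lemma Idelta_zero: "Idelta T (\<lambda>t y. 0) x = 0"
  unfolding Idelta_def by simp

section \<open>Topology, measurability and integration on the path space\<close>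

lemma compact_PiE_paths:
  fixes S :: "nat \<Rightarrow> 'a::topological_space set"
  assumes "\<And>t. t \<in> I \<Longrightarrow> compact (S t)"
  shows "compact (PiE I S)"
proof -
  \<comment> \<open>Off \<open>I\<close> an extensional path has the fixed value
    \<open>undefined\<close>, so the set is a full product with singleton factors and Tychonoff's
    theorem applies.\<close>
  have eq: "PiE I S = PiE UNIV (\<lambda>t. if t \<in> I then S t else {undefined})"
    by (auto simp: PiE_def extensional_def Pi_def split: if_splits)
  have "compactin (product_topology (\<lambda>i. euclidean) UNIV) (PiE UNIV (\<lambda>t. if t \<in> I then S t else {undefined}))"
    using assms by (subst compactin_PiE) auto
  then show ?thesis unfolding eq by (simp add: euclidean_product_topology)
qed

lemma closed_Kset: "(\<And>j. closed (Kc t j)) \<Longrightarrow> closed (Kset Kc t)"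
  unfolding Kset_def by (intro closed_Collect_all continuous_closed_vimage[of _ "\<lambda>y. y $ _", unfolded vimage_def] continuous_intros)

lemma closed_Omega:
  assumes "\<forall>t\<le>T. \<forall>j. closed (Kc t j)"
  shows "closed (Omega T Kc)"
proof -
  have eq: "Omega T Kc = (\<Inter>t. (\<lambda>x. x t) -` (if t \<le> T then Kset Kc t else {undefined}))"
    unfolding Omega_def by (auto simp: PiE_def extensional_def Pi_def split: if_splits)
  have "closed ((\<lambda>x::nat \<Rightarrow> real^'a. x t) -` (if t \<le> T then Kset Kc t else {undefined}))" for t
    using closed_Kset assms by (intro closed_vimage continuous_on_coord) auto
  then show ?thesis unfolding eq by (intro closed_INT) auto
qed

text \<open>It links the product sigma-algebra over \<open>{0..T}\<close> with the Borel sets of the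
  topology on all functions from \<open>nat\<close>, in which continuity is stated. Coordinates
  beyond \<open>T\<close> are constant on the space.\<close>

lemma measurable_path_id: "(\<lambda>x. x) \<in> measurable (path_space T) (borel :: (nat \<Rightarrow> real^'d::finite) measure)"
proof (rule measurable_coordinatewise_then_product)
  fix i
  show "(\<lambda>x. x i) \<in> measurable (path_space T) (borel :: (real^'d) measure)"
  proof (cases "i \<le> T")
    case True
    then show ?thesis unfolding path_space_def by (intro measurable_component_singleton) auto
  next
    case False
    have "(\<lambda>x. x i) \<in> measurable (path_space T) (borel :: (real^'d) measure)
        \<longleftrightarrow> (\<lambda>x::nat \<Rightarrow> real^'d. undefined) \<in> measurable (path_space T) (borel :: (real^'d) measure)"
      by (intro measurable_cong) (use False in \<open>auto simp: path_space_def space_PiM PiE_def extensional_def\<close>)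
    then show ?thesis by simp
  qed
qed

lemma sets_Omega:
  assumes "\<forall>t\<le>T. \<forall>j. closed (Kc t j)"
  shows "Omega T Kc \<in> sets (path_space T)"
  unfolding Omega_def path_space_def using assms
  by (intro sets_PiM_I_finite borel_closed closed_Kset) auto

lemma measurable_lin_growth:
  assumes K: "\<forall>t\<le>T. \<forall>j. closed (Kc t j)" and g: "g \<in> lin_growth T Kc"
  shows "(\<lambda>x. indicator (Omega T Kc) x *\<^sub>R g x) \<in> borel_measurable (path_space T)"
proof -
  have "(\<lambda>x. indicator (Omega T Kc) x *\<^sub>R g x) \<in> borel_measurable borel"
    using g closed_Omega[OF K] by (intro borel_measurable_continuous_on_indicator) (auto simp: lin_growth_def)
  from measurable_compose[OF measurable_path_id this] show ?thesis .
qed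

lemma integrable_weight:
  assumes "Q \<in> Prob1 T Kc"
  shows "integrable Q (weight T)"
proof -
  interpret prob_space Q using assms by (auto simp: Prob1_def)
  show ?thesis
    unfolding weight_def[abs_def] using assms
    by (intro Bochner_Integration.integrable_add Bochner_Integration.integrable_sum integrable_const)
       (auto simp: Prob1_def)
qed

lemma integrable_lin_growth:
  assumes K: "\<forall>t\<le>T. \<forall>j. closed (Kc t j)" and Q: "Q \<in> Prob1 T Kc" and g: "g \<in> lin_growth T Kc"
  shows "set_integrable Q (Omega T Kc) g"
proof -
  obtain C where C: "0 \<le> C" "\<And>x. x \<in> Omega T Kc \<Longrightarrow> \<bar>g x\<bar> \<le> C * weight T x"
    using lin_growthE[OF g] by metis
  have s: "sets Q = sets (path_space T)" using Q by (simp add: Prob1_def)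
  show ?thesis
    unfolding set_integrable_def
  proof (rule Bochner_Integration.integrable_bound)
    show "integrable Q (\<lambda>x. C * weight T x)" using integrable_weight[OF Q] by simp
    show "(\<lambda>x. indicator (Omega T Kc) x *\<^sub>R g x) \<in> borel_measurable Q"
      using measurable_lin_growth[OF K g] measurable_cong_sets[OF s refl] by blast
    have "norm (indicator (Omega T Kc) x *\<^sub>R g x) \<le> norm (C * weight T x)" for x
    proof -
      have "0 \<le> C * weight T x" using C(1) weight_ge_1[of T x] by simp
      then show ?thesis using C(2)[of x] by (cases "x \<in> Omega T Kc") (simp_all add: abs_of_nonneg)
    qed
    then show "AE x in Q. norm (indicator (Omega T Kc) x *\<^sub>R g x) \<le> norm (C * weight T x)" by simp
  qed
qed

lemma AE_Omega:
  assumes K: "\<forall>t\<le>T. \<forall>j. closed (Kc t j)" and Q: "Q \<in> Prob1 T Kc"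
  shows "AE x in Q. x \<in> Omega T Kc"
proof -
  interpret prob_space Q using Q by (auto simp: Prob1_def)
  have "Omega T Kc \<in> sets Q" using Q sets_Omega[OF K] by (auto simp: Prob1_def)
  then show ?thesis using Q by (subst AE_in_set_eq_1) (auto simp: Prob1_def measure_def)
qed

text \<open>After the change of variables the indicators of \<open>Kset Kc t\<close> and of
  \<open>Omega T Kc\<close> differ only on a \<open>Q\<close>-null set, as \<open>Q\<close> is
  carried by \<open>Omega T Kc\<close>.\<close>

lemma integral_marg:
  assumes K: "\<forall>t\<le>T. \<forall>j. closed (Kc t j)" and Q: "Q \<in> Prob1 T Kc" and t: "t \<le> T"
    and \<phi>: "\<phi> \<in> Ct Kc t"
  shows "(LINT y:Kset Kc t|marg Q t. \<phi> y) = (LINT x:Omega T Kc|Q. \<phi> (x t))"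
proof -
  have s: "sets Q = sets (path_space T)" using Q by (simp add: Prob1_def)
  have "(\<lambda>x. x t) \<in> measurable (path_space T) (borel :: (real^'a) measure)"
    unfolding path_space_def using t by (intro measurable_component_singleton) auto
  then have c: "(\<lambda>x. x t) \<in> measurable Q borel" using measurable_cong_sets[OF s refl] by blast
  have \<phi>m: "(\<lambda>y. indicator (Kset Kc t) y *\<^sub>R \<phi> y) \<in> borel_measurable borel"
    using \<phi> closed_Kset[of Kc t] K t
    by (intro borel_measurable_continuous_on_indicator) (auto simp: Ct_def)
  have "(LINT y:Kset Kc t|marg Q t. \<phi> y) = (\<integral>x. indicator (Kset Kc t) (x t) *\<^sub>R \<phi> (x t) \<partial>Q)"
    unfolding set_lebesgue_integral_def marg_def by (rule integral_distr[OF c \<phi>m])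
  also have "\<dots> = (\<integral>x. indicator (Omega T Kc) x *\<^sub>R \<phi> (x t) \<partial>Q)"
  proof (rule integral_cong_AE)
    show "(\<lambda>x. indicator (Kset Kc t) (x t) *\<^sub>R \<phi> (x t)) \<in> borel_measurable Q"
      using measurable_compose[OF c \<phi>m] .
    show "(\<lambda>x. indicator (Omega T Kc) x *\<^sub>R \<phi> (x t)) \<in> borel_measurable Q"
      using measurable_lin_growth[OF K lin_growth_Ct[OF \<phi> t]] measurable_cong_sets[OF s refl] by blast
    show "AE x in Q. indicator (Kset Kc t) (x t) *\<^sub>R \<phi> (x t) = indicator (Omega T Kc) x *\<^sub>R \<phi> (x t)"
      using AE_Omega[OF K Q] by eventually_elim (simp add: OmegaD[OF _ t])
  qed
  finally show ?thesis by (simp add: set_lebesgue_integral_def)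
qed

lemma measurable_lsc:
  assumes K: "\<forall>t\<le>T. \<forall>j. closed (Kc t j)"
    and lsc: "\<And>a. openin (top_of_set (Omega T Kc)) {x \<in> Omega T Kc. a < (c x :: ereal)}"
  shows "(\<lambda>x. if x \<in> Omega T Kc then c x else 0) \<in> borel_measurable (path_space T)"
proof (rule borel_measurableI_greater)
  fix a
  obtain U where U: "open U" "{x \<in> Omega T Kc. a < c x} = Omega T Kc \<inter> U"
    using lsc[of a] by (auto simp: openin_open)
  have "U \<in> sets borel" using U(1) by auto
  from measurable_sets[OF measurable_path_id this]
  have Um: "U \<inter> space (path_space T) \<in> sets (path_space T)" by simp
  have O: "Omega T Kc \<in> sets (path_space T)" by (rule sets_Omega[OF K])
  have "{x \<in> space (path_space T). a < (if x \<in> Omega T Kc then c x else 0)}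
      = (Omega T Kc \<inter> (U \<inter> space (path_space T))) \<union> (if a < 0 then space (path_space T) - Omega T Kc else {})"
    using U(2) sets.sets_into_space[OF O] by auto
  also have "\<dots> \<in> sets (path_space T)" using O Um by auto
  finally show "{x \<in> space (path_space T). a < (if x \<in> Omega T Kc then c x else 0)} \<in> sets (path_space T)" .
qed

text \<open>A real \<open>q\<close> strictly between \<open>a - v x\<close> and \<open>c x\<close>
  separates the two summands, so the set is a union over \<open>q\<close> of relatively open sets;
  this form also covers \<open>c x = \<infinity>\<close>.\<close>

lemma lsc_add_continuous:
  fixes c :: "'a::topological_space \<Rightarrow> ereal" and v :: "'a \<Rightarrow> real"
  assumes lsc: "\<And>a. openin (top_of_set X) {x \<in> X. a < c x}" and v: "continuous_on X v"
    and c: "\<And>x. x \<in> X \<Longrightarrow> c x \<noteq> - \<infinity>"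
  shows "openin (top_of_set X) {x \<in> X. a < c x + ereal (v x)}"
proof -
  have eq: "{x \<in> X. a < c x + ereal (v x)} =
      (\<Union>q. {x \<in> X. ereal q < c x} \<inter> (X \<inter> (\<lambda>x. ereal (q + v x)) -` {a<..}))"
  proof (intro set_eqI iffI)
    fix x assume "x \<in> {x \<in> X. a < c x + ereal (v x)}"
    then have x: "x \<in> X" "a < c x + ereal (v x)" by auto
    then have "a - ereal (v x) < c x" using ereal_minus_less[of "ereal (v x)" a "c x"] by (simp add: add.commute)
    then obtain q where q: "a - ereal (v x) < ereal q" "ereal q < c x"
      using ereal_dense2 by blast
    then have "a < ereal (q + v x)" by (cases a) auto
    then show "x \<in> (\<Union>q. {x \<in> X. ereal q < c x} \<inter> (X \<inter> (\<lambda>x. ereal (q + v x)) -` {a<..}))"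
      using q x by auto
  next
    fix x assume "x \<in> (\<Union>q. {x \<in> X. ereal q < c x} \<inter> (X \<inter> (\<lambda>x. ereal (q + v x)) -` {a<..}))"
    then obtain q where q: "x \<in> X" "ereal q < c x" "a < ereal (q + v x)" by auto
    have "ereal q + ereal (v x) \<le> c x + ereal (v x)" using q(2) by (intro add_right_mono) auto
    then show "x \<in> {x \<in> X. a < c x + ereal (v x)}" using q by (auto intro: less_le_trans)
  qed
  show ?thesis
    unfolding eq
    by (intro openin_Union[of "range _"] ballI)
       (auto intro!: openin_Int lsc continuous_openin_preimage_gen continuous_intros v)
qed

section \<open>Duality\<close>

locale mot =
  fixes T :: nat
    and Kc :: "nat \<Rightarrow> 'd::finite \<Rightarrow> real set"
    and E :: "nat \<Rightarrow> (real^'d \<Rightarrow> real) set"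
    and S :: "nat \<Rightarrow> (real^'d \<Rightarrow> real) \<Rightarrow> real"
    and KK :: "nat \<Rightarrow> nat \<Rightarrow> (real^'d) set"
    and f :: "nat \<Rightarrow> nat \<Rightarrow> real^'d \<Rightarrow> real"
    and c :: "(nat \<Rightarrow> real^'d) \<Rightarrow> ereal"
    and A :: real
  assumes K_closed: "\<forall>t\<le>T. \<forall>j. closed (Kc t j)"
    and E_sub: "t \<le> T \<Longrightarrow> E t \<subseteq> Ct Kc t"
    and E_zero: "t \<le> T \<Longrightarrow> (\<lambda>y. 0) \<in> E t"
    and E_add: "t \<le> T \<Longrightarrow> \<phi> \<in> E t \<Longrightarrow> \<psi> \<in> E t \<Longrightarrow> (\<lambda>y. \<phi> y + \<psi> y) \<in> E t"
    and E_scale: "t \<le> T \<Longrightarrow> \<phi> \<in> E t \<Longrightarrow> (\<lambda>y. a * \<phi> y) \<in> E t"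
    and E_const: "t \<le> T \<Longrightarrow> \<phi> \<in> E t \<Longrightarrow> (\<lambda>y. \<phi> y + k) \<in> E t"
    and S_concave: "t \<le> T \<Longrightarrow> \<phi> \<in> E t \<Longrightarrow> \<psi> \<in> E t \<Longrightarrow> 0 \<le> l \<Longrightarrow> l \<le> 1 \<Longrightarrow>
         S t (\<lambda>y. l * \<phi> y + (1 - l) * \<psi> y) \<ge> l * S t \<phi> + (1 - l) * S t \<psi>"
    and S_cash: "t \<le> T \<Longrightarrow> \<phi> \<in> E t \<Longrightarrow> S t (\<lambda>y. \<phi> y + k) = S t \<phi> + k"
    and S_zero: "t \<le> T \<Longrightarrow> S t (\<lambda>y. 0) = 0"
    and KK_compact: "t \<le> T \<Longrightarrow> n \<ge> 1 \<Longrightarrow> compact (KK t n) \<and> KK t n \<subseteq> Kset Kc t"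
    and f_in: "t \<le> T \<Longrightarrow> n \<ge> 1 \<Longrightarrow> f t n \<in> E t \<and> (\<forall>y\<in>Kset Kc t. 0 \<le> f t n y)"
    and f_dom: "n \<ge> 1 \<Longrightarrow> x \<in> Omega T Kc - PiE {0..T} (\<lambda>t. KK t n) \<Longrightarrow>
         weight T x \<le> (\<Sum>t\<le>T. f t n (x t))"
    and V_lim: "\<Gamma> > 0 \<Longrightarrow> (\<lambda>n. - (\<Sum>t\<le>T. S t (\<lambda>y. - (\<Gamma> * f t n y)))) \<longlonglongrightarrow> 0"
    and c_lsc: "\<And>a. openin (top_of_set (Omega T Kc)) {x \<in> Omega T Kc. a < c x}"
    and A_nonneg: "A \<ge> 0"
    and c_bound: "x \<in> Omega T Kc \<Longrightarrow> c x \<ge> ereal (- A * weight T x)"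
begin

abbreviation "\<Omega> \<equiv> Omega T Kc"
abbreviation "B \<equiv> lin_growth T Kc"

definition U :: "(nat \<Rightarrow> real^'d \<Rightarrow> real) \<Rightarrow> real" where
  "U \<phi> = (\<Sum>t\<le>T. S t (\<phi> t))"

text \<open>Feasibility for the cost \<open>c + x\<close>; the case \<open>x = 0\<close> is the
  constraint of the primal problem. The strategy is quantified away because it does not enter the
  objective \<open>U\<close>.\<close>

definition adm :: "((nat \<Rightarrow> real^'d) \<Rightarrow> real) \<Rightarrow> (nat \<Rightarrow> real^'d \<Rightarrow> real) set" where
  "adm x = {\<phi>. (\<forall>t\<le>T. \<phi> t \<in> E t) \<and> (\<exists>\<Delta>\<in>Hstrat T Kc. \<forall>\<omega>\<in>\<Omega>.
      ereal ((\<Sum>t\<le>T. \<phi> t (\<omega> t)) + Idelta T \<Delta> \<omega>) \<le> c \<omega> + ereal (x \<omega>))}"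

definition dual_value :: "(nat \<Rightarrow> real^'d) measure \<Rightarrow> ereal" where
  "dual_value Q = ereal_expect Q \<Omega> c + (\<Sum>t\<le>T. Dpen (Kset Kc t) (E t) (S t) (marg Q t))"

definition F :: "nat \<Rightarrow> (nat \<Rightarrow> real^'d) \<Rightarrow> real" where
  "F n \<omega> = (\<Sum>t\<le>T. f t n (\<omega> t))"

section \<open>Feasible sets of the perturbed primal problem\<close>

lemma E_lin: "t \<le> T \<Longrightarrow> \<phi> \<in> E t \<Longrightarrow> \<psi> \<in> E t \<Longrightarrow> (\<lambda>y. a * \<phi> y + b * \<psi> y) \<in> E t"
  by (intro E_add E_scale)

lemma E_B: "t \<le> T \<Longrightarrow> \<phi> \<in> E t \<Longrightarrow> (\<lambda>x. \<phi> (x t)) \<in> B"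
  using E_sub by (intro lin_growth_Ct) auto

lemma E_sum_B: "(\<And>t. t \<le> T \<Longrightarrow> \<phi> t \<in> E t) \<Longrightarrow> (\<lambda>x. \<Sum>t\<le>T. \<phi> t (x t)) \<in> B"
  by (intro lin_growth_sum E_B) auto

lemma F_B: "n \<ge> 1 \<Longrightarrow> F n \<in> B"
  unfolding F_def[abs_def] using f_in by (intro E_sum_B) auto

lemma F_nonneg: "n \<ge> 1 \<Longrightarrow> \<omega> \<in> \<Omega> \<Longrightarrow> 0 \<le> F n \<omega>"
  unfolding F_def by (intro sum_nonneg) (simp add: f_in OmegaD)

lemma c_not_MInf: "\<omega> \<in> \<Omega> \<Longrightarrow> c \<omega> \<noteq> - \<infinity>"
  using c_bound[of \<omega>] by auto

lemma compact_KK: "n \<ge> 1 \<Longrightarrow> compact (PiE {0..T} (\<lambda>t. KK t n))"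
  using KK_compact by (intro compact_PiE_paths) auto

text \<open>On the first compact box \<open>weight\<close> is bounded by continuity, and off it
  \<open>f_dom\<close> applies. Every growth bound thus becomes a bound by elements of the
  \<open>E t\<close> and a constant.\<close>

lemma weight_le_F:
  obtains C where "0 \<le> C" "\<And>\<omega>. \<omega> \<in> \<Omega> \<Longrightarrow> weight T \<omega> \<le> C + F 1 \<omega>"
proof -
  have "bounded (weight T ` PiE {0..T} (\<lambda>t. KK t 1))"
    by (intro compact_imp_bounded compact_continuous_image continuous_on_weight compact_KK) simp
  then obtain C where C: "\<And>\<omega>. \<omega> \<in> PiE {0..T} (\<lambda>t. KK t 1) \<Longrightarrow> \<bar>weight T \<omega>\<bar> \<le> C"
    unfolding bounded_iff by (auto simp: real_norm_def)
  have "weight T \<omega> \<le> \<bar>C\<bar> + F 1 \<omega>" if "\<omega> \<in> \<Omega>" for \<omega>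
  proof (cases "\<omega> \<in> PiE {0..T} (\<lambda>t. KK t 1)")
    case True
    then show ?thesis using C[OF True] F_nonneg[of 1, OF _ that] by simp
  next
    case False
    then show ?thesis using f_dom[of 1 \<omega>] that by (simp add: F_def)
  qed
  then show thesis using that[of "\<bar>C\<bar>"] by auto
qed

lemma adm_convex:
  assumes "\<phi> \<in> adm x" "\<psi> \<in> adm y" and l: "0 \<le> l" "l \<le> 1"
  shows "\<exists>\<eta>\<in>adm (\<lambda>\<omega>. l * x \<omega> + (1 - l) * y \<omega>). l * U \<phi> + (1 - l) * U \<psi> \<le> U \<eta>"
proof
  let ?\<eta> = "\<lambda>t z. l * \<phi> t z + (1 - l) * \<psi> t z"
  obtain \<Delta> where \<phi>: "\<And>t. t \<le> T \<Longrightarrow> \<phi> t \<in> E t" "\<Delta> \<in> Hstrat T Kc"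
      "\<And>\<omega>. \<omega> \<in> \<Omega> \<Longrightarrow> ereal ((\<Sum>t\<le>T. \<phi> t (\<omega> t)) + Idelta T \<Delta> \<omega>) \<le> c \<omega> + ereal (x \<omega>)"
    using assms(1) unfolding adm_def by auto
  obtain \<Delta>' where \<psi>: "\<And>t. t \<le> T \<Longrightarrow> \<psi> t \<in> E t" "\<Delta>' \<in> Hstrat T Kc"
      "\<And>\<omega>. \<omega> \<in> \<Omega> \<Longrightarrow> ereal ((\<Sum>t\<le>T. \<psi> t (\<omega> t)) + Idelta T \<Delta>' \<omega>) \<le> c \<omega> + ereal (y \<omega>)"
    using assms(2) unfolding adm_def by auto
  let ?\<Delta> = "\<lambda>t y. l *\<^sub>R \<Delta> t y + (1 - l) *\<^sub>R \<Delta>' t y"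
  have "ereal ((\<Sum>t\<le>T. ?\<eta> t (\<omega> t)) + Idelta T ?\<Delta> \<omega>) \<le> c \<omega> + ereal (l * x \<omega> + (1 - l) * y \<omega>)"
    if \<omega>: "\<omega> \<in> \<Omega>" for \<omega>
  proof (cases "c \<omega>")
    case (real r)
    let ?a = "(\<Sum>t\<le>T. \<phi> t (\<omega> t)) + Idelta T \<Delta> \<omega>" and ?b = "(\<Sum>t\<le>T. \<psi> t (\<omega> t)) + Idelta T \<Delta>' \<omega>"
    have "?a \<le> r + x \<omega>" "?b \<le> r + y \<omega>" using \<phi>(3)[OF \<omega>] \<psi>(3)[OF \<omega>] real by auto
    then have "l * ?a + (1 - l) * ?b \<le> l * (r + x \<omega>) + (1 - l) * (r + y \<omega>)"
      using l by (intro add_mono[OF mult_left_mono mult_left_mono]) auto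
    also have "\<dots> = r + (l * x \<omega> + (1 - l) * y \<omega>)" by (simp add: algebra_simps)
    also have "l * ?a + (1 - l) * ?b = (\<Sum>t\<le>T. ?\<eta> t (\<omega> t)) + Idelta T ?\<Delta> \<omega>"
      unfolding Idelta_lin sum.distrib sum_distrib_left[symmetric] by (simp add: algebra_simps)
    finally show ?thesis using real by simp
  qed (use c_not_MInf[OF \<omega>] in auto)
  then show "?\<eta> \<in> adm (\<lambda>\<omega>. l * x \<omega> + (1 - l) * y \<omega>)"
    unfolding adm_def using \<phi>(1) \<psi>(1) Hstrat_lin[OF \<phi>(2) \<psi>(2)] E_lin by blast
  have "l * U \<phi> + (1 - l) * U \<psi> = (\<Sum>t\<le>T. l * S t (\<phi> t) + (1 - l) * S t (\<psi> t))"
    by (simp add: U_def sum_distrib_left sum.distrib)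
  also have "\<dots> \<le> U ?\<eta>"
    unfolding U_def using l \<phi>(1) \<psi>(1) by (intro sum_mono S_concave) auto
  finally show "l * U \<phi> + (1 - l) * U \<psi> \<le> U ?\<eta>" .
qed

text \<open>The constant \<open>k\<close> is spread equally over the \<open>T + 1\<close> dates, and
  cash additivity collects the pieces.\<close>

lemma adm_shift:
  assumes "\<phi> \<in> adm x"
  shows "(\<lambda>t z. \<phi> t z + k / real (T + 1)) \<in> adm (\<lambda>\<omega>. x \<omega> + k)"
    and "U (\<lambda>t z. \<phi> t z + k / real (T + 1)) = U \<phi> + k"
proof -
  have s: "(\<Sum>t\<le>T. k / real (T + 1)) = k" by (simp add: field_simps)
  obtain \<Delta> where \<phi>: "\<And>t. t \<le> T \<Longrightarrow> \<phi> t \<in> E t" "\<Delta> \<in> Hstrat T Kc"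
      "\<And>\<omega>. \<omega> \<in> \<Omega> \<Longrightarrow> ereal ((\<Sum>t\<le>T. \<phi> t (\<omega> t)) + Idelta T \<Delta> \<omega>) \<le> c \<omega> + ereal (x \<omega>)"
    using assms(1) unfolding adm_def by auto
  have "ereal ((\<Sum>t\<le>T. \<phi> t (\<omega> t) + k / real (T + 1)) + Idelta T \<Delta> \<omega>) \<le> c \<omega> + ereal (x \<omega> + k)"
    if "\<omega> \<in> \<Omega>" for \<omega>
    unfolding sum.distrib s using \<phi>(3)[OF that] by (cases "c \<omega>") auto
  then show "(\<lambda>t z. \<phi> t z + k / real (T + 1)) \<in> adm (\<lambda>\<omega>. x \<omega> + k)"
    unfolding adm_def using \<phi>(1,2) E_const by blast
  show "U (\<lambda>t z. \<phi> t z + k / real (T + 1)) = U \<phi> + k"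
    unfolding U_def using \<phi>(1) s by (simp add: S_cash sum.distrib)
qed

lemma adm_mono:
  assumes "\<phi> \<in> adm x" "\<And>\<omega>. \<omega> \<in> \<Omega> \<Longrightarrow> x \<omega> \<le> y \<omega>"
  shows "\<phi> \<in> adm y"
proof -
  have "c \<omega> + ereal (x \<omega>) \<le> c \<omega> + ereal (y \<omega>)" if "\<omega> \<in> \<Omega>" for \<omega>
    using assms(2)[OF that] by (intro add_left_mono) auto
  then show ?thesis using assms(1) unfolding adm_def by (blast intro: order_trans)
qed

lemma adm_direct:
  assumes "\<And>t. t \<le> T \<Longrightarrow> \<phi> t \<in> E t"
    and "\<And>\<omega>. \<omega> \<in> \<Omega> \<Longrightarrow> (\<Sum>t\<le>T. \<phi> t (\<omega> t)) \<le> x \<omega> - A * weight T \<omega>"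
  shows "\<phi> \<in> adm x"
proof -
  have "ereal ((\<Sum>t\<le>T. \<phi> t (\<omega> t)) + Idelta T (\<lambda>t y. 0) \<omega>) \<le> c \<omega> + ereal (x \<omega>)" if "\<omega> \<in> \<Omega>" for \<omega>
  proof -
    have "ereal (\<Sum>t\<le>T. \<phi> t (\<omega> t)) \<le> ereal (- A * weight T \<omega>) + ereal (x \<omega>)"
      using assms(2)[OF that] by simp
    also have "\<dots> \<le> c \<omega> + ereal (x \<omega>)" by (intro add_right_mono c_bound that)
    finally show ?thesis by (simp add: Idelta_zero)
  qed
  then show ?thesis unfolding adm_def using assms(1) Hstrat_zero by blast
qed

lemma adm_nonempty:
  assumes "x \<in> B"
  shows "adm x \<noteq> {}"
proof -
  obtain C where C: "0 \<le> C" "\<And>\<omega>. \<omega> \<in> \<Omega> \<Longrightarrow> weight T \<omega> \<le> C + F 1 \<omega>" using weight_le_F by blast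
  obtain D where D: "0 \<le> D" "\<And>\<omega>. \<omega> \<in> \<Omega> \<Longrightarrow> \<bar>x \<omega>\<bar> \<le> D * weight T \<omega>" using lin_growthE[OF assms] by metis
  \<comment> \<open>The amount \<open>A\<close> covers the lower bound of \<open>c\<close> and
    \<open>D\<close> that of \<open>x\<close>; both are multiples of \<open>weight\<close>, hence of
    \<open>C + F 1\<close>. The surplus \<open>(A + D) * C\<close> is removed afterwards by a
    shift.\<close>
  let ?\<phi> = "\<lambda>t z. - (A + D) * f t 1 z + 0"
  have "?\<phi> \<in> adm (\<lambda>\<omega>. x \<omega> + (A + D) * C)"
  proof (rule adm_direct)
    show "t \<le> T \<Longrightarrow> ?\<phi> t \<in> E t" for t using f_in[of t 1] by (intro E_const E_scale) auto
    fix \<omega> assume \<omega>: "\<omega> \<in> \<Omega>"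
    have "(A + D) * weight T \<omega> \<le> (A + D) * (C + F 1 \<omega>)"
      using C(2)[OF \<omega>] A_nonneg D(1) by (intro mult_left_mono) auto
    moreover have "(\<Sum>t\<le>T. ?\<phi> t (\<omega> t)) = - (A + D) * F 1 \<omega>"
      by (simp only: F_def sum_distrib_left add_0_right)
    ultimately show "(\<Sum>t\<le>T. ?\<phi> t (\<omega> t)) \<le> x \<omega> + (A + D) * C - A * weight T \<omega>"
      using D(2)[OF \<omega>] by (simp add: algebra_simps abs_le_iff)
  qed
  from adm_shift(1)[OF this, of "- ((A + D) * C)"] show ?thesis by auto
qed

text \<open>The witness must cover both \<open>- \<Gamma> * F n\<close> and the lower bound of
  \<open>c\<close>. It is the midpoint of \<open>-2 \<Gamma> f t n\<close> and
  \<open>-2 A f t 1\<close>, so concavity separates the two demands. \<open>D\<close> collects the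
  second half and the constant, and hence is independent of \<open>\<Gamma>\<close> and
  \<open>n\<close>; \<open>V_lim\<close> controls the rest.\<close>

lemma U_tight:
  obtains D where "\<And>\<Gamma> n. n \<ge> 1 \<Longrightarrow> \<exists>\<phi>\<in>adm (\<lambda>\<omega>. - \<Gamma> * F n \<omega>).
    D + (1/2) * (\<Sum>t\<le>T. S t (\<lambda>y. - (2 * \<Gamma> * f t n y))) \<le> U \<phi>"
proof -
  obtain C where C: "0 \<le> C" "\<And>\<omega>. \<omega> \<in> \<Omega> \<Longrightarrow> weight T \<omega> \<le> C + F 1 \<omega>" using weight_le_F by blast
  define D where "D = (1/2) * (\<Sum>t\<le>T. S t (\<lambda>y. - (2 * A) * f t 1 y)) - A * C"
  have "\<exists>\<phi>\<in>adm (\<lambda>\<omega>. - \<Gamma> * F n \<omega>).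
    D + (1/2) * (\<Sum>t\<le>T. S t (\<lambda>y. - (2 * \<Gamma> * f t n y))) \<le> U \<phi>" if n: "n \<ge> 1" for \<Gamma> n
  proof -
    let ?\<phi> = "\<lambda>t z. (1/2) * (- (2 * \<Gamma>) * f t n z) + (1 - 1/2) * (- (2 * A) * f t 1 z)"
    have E1: "(\<lambda>z. - (2 * \<Gamma>) * f t n z) \<in> E t" "(\<lambda>z. - (2 * A) * f t 1 z) \<in> E t" if "t \<le> T" for t
      using f_in[OF that n] f_in[OF that, of 1] that by (intro E_scale; simp)+
    have ph: "?\<phi> \<in> adm (\<lambda>\<omega>. - \<Gamma> * F n \<omega> + A * C)"
    proof (rule adm_direct)
      show "t \<le> T \<Longrightarrow> ?\<phi> t \<in> E t" for t using E1[of t] by (intro E_lin) auto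
      fix \<omega> assume \<omega>: "\<omega> \<in> \<Omega>"
      have "A * weight T \<omega> \<le> A * (C + F 1 \<omega>)"
        using C(2)[OF \<omega>] A_nonneg by (intro mult_left_mono) auto
      moreover have "(\<Sum>t\<le>T. ?\<phi> t (\<omega> t)) = - \<Gamma> * F n \<omega> - A * F 1 \<omega>"
        by (simp add: F_def sum_distrib_left sum_subtractf sum.distrib sum_negf)
      ultimately show "(\<Sum>t\<le>T. ?\<phi> t (\<omega> t)) \<le> - \<Gamma> * F n \<omega> + A * C - A * weight T \<omega>"
        by (simp add: algebra_simps)
    qed
    have "(1/2) * (\<Sum>t\<le>T. S t (\<lambda>y. - (2 * \<Gamma>) * f t n y)) + (1 - 1/2) * (\<Sum>t\<le>T. S t (\<lambda>y. - (2 * A) * f t 1 y))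
        = (\<Sum>t\<le>T. (1/2) * S t (\<lambda>y. - (2 * \<Gamma>) * f t n y) + (1 - 1/2) * S t (\<lambda>y. - (2 * A) * f t 1 y))"
      unfolding sum.distrib sum_distrib_left ..
    also have "\<dots> \<le> U ?\<phi>"
      unfolding U_def using E1 by (intro sum_mono S_concave) auto
    finally have "D + (1/2) * (\<Sum>t\<le>T. S t (\<lambda>y. - (2 * \<Gamma> * f t n y))) \<le> U ?\<phi> + - (A * C)"
      by (simp add: D_def)
    then show ?thesis
      using adm_shift[OF ph, of "- (A * C)"] by (intro bexI) auto
  qed
  then show thesis by (rule that)
qed

section \<open>Penalties and weak duality\<close>

lemma Dpen_ge:
  assumes "Q \<in> Prob1 T Kc" "t \<le> T" "\<phi> \<in> E t"
  shows "ereal (S t \<phi> - (LINT x:\<Omega>|Q. \<phi> (x t))) \<le> Dpen (Kset Kc t) (E t) (S t) (marg Q t)"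
proof -
  have "\<phi> \<in> Ct Kc t" using E_sub assms by blast
  then have "(LINT x:\<Omega>|Q. \<phi> (x t)) = (LINT y:Kset Kc t|marg Q t. \<phi> y)"
    using integral_marg[OF K_closed assms(1,2)] by simp
  then show ?thesis unfolding Dpen_def using assms(3) by (auto intro: SUP_upper)
qed

lemma Dpen_nonneg:
  assumes "Q \<in> Prob1 T Kc" "t \<le> T"
  shows "0 \<le> Dpen (Kset Kc t) (E t) (S t) (marg Q t)"
  using Dpen_ge[OF assms E_zero[OF assms(2)]] S_zero[OF assms(2)] by (simp add: zero_ereal_def)

lemma set_integral_sum_paths:
  assumes Q: "Q \<in> Prob1 T Kc" and "\<And>t. t \<le> T \<Longrightarrow> \<phi> t \<in> E t"
  shows "(LINT x:\<Omega>|Q. \<Sum>t\<le>T. \<phi> t (x t)) = (\<Sum>t\<le>T. LINT x:\<Omega>|Q. \<phi> t (x t))"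
  using integrable_lin_growth[OF K_closed Q E_B[OF _ assms(2)]]
  unfolding set_lebesgue_integral_def set_integrable_def scaleR_sum_right
  by (intro Bochner_Integration.integral_sum) auto

lemma weak_duality:
  assumes Q: "Q \<in> Mart T Kc" and \<phi>: "\<phi> \<in> adm (\<lambda>\<omega>. 0)"
  shows "ereal (U \<phi>) \<le> dual_value Q"
proof -
  have Q1: "Q \<in> Prob1 T Kc" using Q by (simp add: Mart_def)
  then have sQ: "sets Q = sets (path_space T)" by (simp add: Prob1_def)
  obtain \<Delta> where \<phi>E: "\<And>t. t \<le> T \<Longrightarrow> \<phi> t \<in> E t" and \<Delta>: "\<Delta> \<in> Hstrat T Kc" and
      le: "\<And>\<omega>. \<omega> \<in> \<Omega> \<Longrightarrow> ereal ((\<Sum>t\<le>T. \<phi> t (\<omega> t)) + Idelta T \<Delta> \<omega>) \<le> c \<omega>"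
    using \<phi> unfolding adm_def by auto
  have i1: "set_integrable Q \<Omega> (\<lambda>x. \<Sum>t\<le>T. \<phi> t (x t))"
    by (rule integrable_lin_growth[OF K_closed Q1 E_sum_B[OF \<phi>E]])
  have i2: "set_integrable Q \<Omega> (Idelta T \<Delta>)"
    by (rule integrable_lin_growth[OF K_closed Q1 lin_growth_Idelta[OF \<Delta>]])
  have cm: "(\<lambda>x. if x \<in> \<Omega> then c x else 0) \<in> borel_measurable Q"
    using measurable_lsc[OF K_closed c_lsc] measurable_cong_sets[OF sQ refl] by blast
  have "ereal (LINT x:\<Omega>|Q. (\<Sum>t\<le>T. \<phi> t (x t)) + Idelta T \<Delta> x) \<le> ereal_expect Q \<Omega> c"
  proof (rule set_integral_le_ereal_expect[OF cm])
    show "integrable Q (\<lambda>x. A * weight T x)" using integrable_weight[OF Q1] by simp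
    show "0 \<le> A * weight T x" for x using A_nonneg weight_ge_1[of T x] by simp
    show "ereal (- (A * weight T x)) \<le> c x" if "x \<in> \<Omega>" for x using c_bound[OF that] by simp
    show "set_integrable Q \<Omega> (\<lambda>x. (\<Sum>t\<le>T. \<phi> t (x t)) + Idelta T \<Delta> x)" by (intro set_integral_add i1 i2)
  qed (rule le)
  moreover have "(LINT x:\<Omega>|Q. (\<Sum>t\<le>T. \<phi> t (x t)) + Idelta T \<Delta> x) = (\<Sum>t\<le>T. LINT x:\<Omega>|Q. \<phi> t (x t))"
    using set_integral_add(2)[OF i1 i2] set_integral_sum_paths[OF Q1 \<phi>E] Q \<Delta> by (simp add: Mart_def)
  \<comment> \<open>\<open>U \<phi>\<close> splits into the integrals of the
    \<open>\<phi> t\<close>, whose sum is the expectation of the whole hedge because the strategy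
    term has mean zero, and the excesses of \<open>S t\<close> over these integrals, which the
    penalties dominate.\<close>
  moreover have "ereal (\<Sum>t\<le>T. S t (\<phi> t) - (LINT x:\<Omega>|Q. \<phi> t (x t)))
      \<le> (\<Sum>t\<le>T. Dpen (Kset Kc t) (E t) (S t) (marg Q t))"
    unfolding sum_ereal[symmetric] using Dpen_ge[OF Q1] \<phi>E by (intro sum_mono) auto
  ultimately have "ereal (\<Sum>t\<le>T. LINT x:\<Omega>|Q. \<phi> t (x t))
      + ereal (\<Sum>t\<le>T. S t (\<phi> t) - (LINT x:\<Omega>|Q. \<phi> t (x t))) \<le> dual_value Q"
    unfolding dual_value_def by (intro add_mono) auto
  then show ?thesis by (simp add: U_def sum_subtractf)
qed

text \<open>The functional to which Hahn--Banach is applied is the value of the primal problem with the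
  cost \<open>c\<close> perturbed by \<open>x \<in> B\<close>; perturbing \<open>c\<close> itself
  avoids any compactness argument when \<open>c\<close> is only lower semicontinuous.\<close>

lemma ex_supergradient:
  assumes bdd: "\<And>\<phi>. \<phi> \<in> adm (\<lambda>\<omega>. 0) \<Longrightarrow> U \<phi> \<le> P"
    and P: "\<And>p. (\<And>\<phi>. \<phi> \<in> adm (\<lambda>\<omega>. 0) \<Longrightarrow> U \<phi> \<le> p) \<Longrightarrow> P \<le> p"
  shows "\<exists>L. (\<forall>x\<in>B. \<forall>y\<in>B. \<forall>a b. L (\<lambda>z. a * x z + b * y z) = a * L x + b * L y) \<and>
    (\<forall>x\<in>B. \<forall>\<phi>\<in>adm x. U \<phi> \<le> P + L x)"
proof -
  define r where "r x = (SUP \<phi>\<in>adm x. U \<phi>)" for x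
  have neg: "(\<lambda>z. - x z) \<in> B" if "x \<in> B" for x using lin_growth_scale[OF that, of "-1"] by simp
  \<comment> \<open>One feasible \<open>\<psi>\<close> for \<open>-x\<close> bounds \<open>U\<close>
    on \<open>adm x\<close>: the midpoint of the two is feasible for the perturbation 0, where
    \<open>P\<close> is an upper bound.\<close>
  have bd: "bdd_above (U ` adm x)" if x: "x \<in> B" for x
  proof -
    obtain \<psi> where \<psi>: "\<psi> \<in> adm (\<lambda>z. - x z)" using adm_nonempty[OF neg[OF x]] by blast
    have "U \<phi> \<le> 2 * P - U \<psi>" if \<phi>: "\<phi> \<in> adm x" for \<phi>
    proof -
      have "(\<lambda>\<omega>. (1/2) * x \<omega> + (1 - 1/2) * - x \<omega>) = (\<lambda>\<omega>. 0)" by simp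
      then obtain \<eta> where "\<eta> \<in> adm (\<lambda>\<omega>. 0)" "(1/2) * U \<phi> + (1 - 1/2) * U \<psi> \<le> U \<eta>"
        using adm_convex[OF \<phi> \<psi>, of "1/2"] by auto
      then show ?thesis using bdd[of \<eta>] by simp
    qed
    then show ?thesis by (intro bdd_aboveI2)
  qed
  have r_ge: "U \<phi> \<le> r x" if "x \<in> B" "\<phi> \<in> adm x" for \<phi> x
    unfolding r_def by (rule cSUP_upper[OF that(2) bd[OF that(1)]])
  have r_ap: "\<exists>\<phi>\<in>adm x. r x - e < U \<phi>" if "x \<in> B" "e > 0" for x and e :: real
    using less_cSUP_iff[OF adm_nonempty[OF that(1)] bd[OF that(1)], of "r x - e"] that(2)
    unfolding r_def by auto
  have r0: "r (\<lambda>\<omega>. 0) = P"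
  proof (rule antisym)
    show "r (\<lambda>\<omega>. 0) \<le> P"
      unfolding r_def by (rule cSUP_least[OF adm_nonempty[OF lin_growth_const] bdd])
    show "P \<le> r (\<lambda>\<omega>. 0)" by (rule P) (rule r_ge[OF lin_growth_const])
  qed
  have conc: "l * r x + (1 - l) * r y \<le> r (\<lambda>z. l * x z + (1 - l) * y z)"
    if xy: "x \<in> B" "y \<in> B" and l: "0 \<le> l" "l \<le> 1" for x y l
  proof (rule field_le_epsilon)
    fix e :: real assume e: "e > 0"
    obtain \<phi> where \<phi>: "\<phi> \<in> adm x" "r x - e < U \<phi>" using r_ap[OF xy(1) e] by blast
    obtain \<psi> where \<psi>: "\<psi> \<in> adm y" "r y - e < U \<psi>" using r_ap[OF xy(2) e] by blast
    obtain \<eta> where \<eta>: "\<eta> \<in> adm (\<lambda>z. l * x z + (1 - l) * y z)" "l * U \<phi> + (1 - l) * U \<psi> \<le> U \<eta>"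
      using adm_convex[OF \<phi>(1) \<psi>(1) l] by blast
    have "l * (r x - e) + (1 - l) * (r y - e) \<le> l * U \<phi> + (1 - l) * U \<psi>"
      using \<phi> \<psi> l by (intro add_mono mult_left_mono) auto
    also have "\<dots> \<le> r (\<lambda>z. l * x z + (1 - l) * y z)"
      using \<eta>(2) r_ge[OF lin_growth_lin[OF xy] \<eta>(1)] by (rule order_trans)
    finally show "l * r x + (1 - l) * r y \<le> r (\<lambda>z. l * x z + (1 - l) * y z) + e"
      by (simp add: algebra_simps)
  qed
  \<comment> \<open>The reflected value function is convex with \<open>q 0 = 0\<close>; a linear
    minorant of it, evaluated at \<open>-x\<close>, is the supergradient inequality at
    \<open>x\<close>.\<close>
  define q where "q x = P - r (\<lambda>z. - x z)" for x
  have "\<exists>L. (\<forall>x\<in>B. L x \<le> q x) \<and>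
    (\<forall>x\<in>B. \<forall>y\<in>B. \<forall>a b. L (\<lambda>z. a * x z + b * y z) = a * L x + b * L y)"
  proof (rule Hahn_Banach_convex)
    show "B \<noteq> {}" using lin_growth_const by blast
    show "q (\<lambda>z. 0) = 0" by (simp add: q_def r0)
    show "(\<lambda>z. a * x z + b * y z) \<in> B" if "x \<in> B" "y \<in> B" for x y a b
      by (rule lin_growth_lin[OF that])
    fix x y and l :: real assume xy: "x \<in> B" "y \<in> B" and l: "0 \<le> l" "l \<le> 1"
    have "(\<lambda>z. - (l * x z + (1 - l) * y z)) = (\<lambda>z. l * - x z + (1 - l) * - y z)" by auto
    then show "q (\<lambda>z. l * x z + (1 - l) * y z) \<le> l * q x + (1 - l) * q y"
      using conc[OF neg[OF xy(1)] neg[OF xy(2)] l] by (simp add: q_def algebra_simps)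
  qed
  then obtain L where L: "\<And>x. x \<in> B \<Longrightarrow> L x \<le> q x"
    "\<forall>x\<in>B. \<forall>y\<in>B. \<forall>a b. L (\<lambda>z. a * x z + b * y z) = a * L x + b * L y" by blast
  have "U \<phi> \<le> P + L x" if x: "x \<in> B" and \<phi>: "\<phi> \<in> adm x" for x \<phi>
  proof -
    have "L (\<lambda>z. - x z) = - L x" using L(2)[rule_format, OF x x, of "-1" 0] by simp
    then show ?thesis using L(1)[OF neg[OF x]] r_ge[OF x \<phi>] by (simp add: q_def)
  qed
  then show ?thesis using L(2) by blast
qed

section \<open>Representing measure and strong duality\<close>

lemma supergradient_represented:
  assumes bdd: "\<And>\<phi>. \<phi> \<in> adm (\<lambda>\<omega>. 0) \<Longrightarrow> U \<phi> \<le> P"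
    and P: "\<And>p. (\<And>\<phi>. \<phi> \<in> adm (\<lambda>\<omega>. 0) \<Longrightarrow> U \<phi> \<le> p) \<Longrightarrow> P \<le> p"
    and lin: "\<forall>x\<in>B. \<forall>y\<in>B. \<forall>a b. L (\<lambda>z. a * x z + b * y z) = a * L x + b * L y"
    and sup: "\<And>x \<phi>. x \<in> B \<Longrightarrow> \<phi> \<in> adm x \<Longrightarrow> U \<phi> \<le> P + L x"
  shows "\<exists>M. space M = \<Omega> \<and> (\<forall>g\<in>B. integrable M g \<and> integral\<^sup>L M g = L g) \<and> L (\<lambda>z. 1) = 1"
proof -
  have L_scale: "L (\<lambda>z. a * x z) = a * L x" if "x \<in> B" for x a
    using lin[rule_format, OF that that, of a 0] by simp
  \<comment> \<open>If \<open>x\<close> is nonnegative on \<open>\<Omega>\<close>, everything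
    feasible at 0 stays feasible at \<open>x\<close>, so \<open>P + L x\<close> is an upper bound of
    the original problem.\<close>
  have L_pos: "0 \<le> L x" if x: "x \<in> B" "\<And>z. z \<in> \<Omega> \<Longrightarrow> 0 \<le> x z" for x
  proof -
    have "P \<le> P + L x"
      by (rule P) (rule sup[OF x(1) adm_mono], use x in auto)
    then show ?thesis by simp
  qed
  have L_mono: "L x \<le> L y" if "x \<in> B" "y \<in> B" "\<And>z. z \<in> \<Omega> \<Longrightarrow> x z \<le> y z" for x y
    using L_pos[OF lin_growth_diff[OF that(2,1)]] lin[rule_format, OF that(2,1), of 1 "-1"] that(3) by simp
  \<comment> \<open>Perturbing by a constant \<open>k\<close> of either sign raises \<open>U\<close>
    by exactly \<open>k\<close>; the cases 1 and -1 pin down \<open>L 1\<close>.\<close>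
  have Lk: "k \<le> k * L (\<lambda>z. 1)" for k
  proof -
    have "P \<le> P + k * L (\<lambda>z. 1) - k"
    proof (rule P)
      fix \<phi> assume "\<phi> \<in> adm (\<lambda>\<omega>. 0)"
      from adm_shift[OF this, of k] show "U \<phi> \<le> P + k * L (\<lambda>z. 1) - k"
        using sup[OF lin_growth_const[of k]] L_scale[OF lin_growth_const[of 1], of k] by fastforce
    qed
    then show ?thesis by simp
  qed
  have L1: "L (\<lambda>z. 1) = 1" using Lk[of 1] Lk[of "-1"] by simp
  obtain D where D: "\<And>\<Gamma> n. n \<ge> 1 \<Longrightarrow> \<exists>\<phi>\<in>adm (\<lambda>\<omega>. - \<Gamma> * F n \<omega>).
    D + (1/2) * (\<Sum>t\<le>T. S t (\<lambda>y. - (2 * \<Gamma> * f t n y))) \<le> U \<phi>"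
    using U_tight by blast
  have tight: "\<exists>n\<ge>1. L (F n) \<le> e" if e: "e > 0" for e
  proof -
    \<comment> \<open>For large \<open>n\<close> the limit assumption at \<open>2 * \<Gamma>\<close>
      costs less than 2, which the factor 1/2 in \<open>D\<close>'s bound turns into the
      \<open>+ 1\<close> here; then \<open>\<Gamma> * L (F n)\<close> is at most
      \<open>\<Gamma> * e\<close>.\<close>
    define \<Gamma> where "\<Gamma> = (\<bar>P - D\<bar> + 1) / e"
    have \<Gamma>: "\<Gamma> > 0" using e by (simp add: \<Gamma>_def)
    have "\<forall>\<^sub>F n in sequentially. - (\<Sum>t\<le>T. S t (\<lambda>y. - (2 * \<Gamma> * f t n y))) < 2"
      using order_tendstoD(2)[OF V_lim[of "2 * \<Gamma>"], of 2] \<Gamma> by simp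
    then have "\<forall>\<^sub>F n in sequentially. n \<ge> 1 \<and> - (\<Sum>t\<le>T. S t (\<lambda>y. - (2 * \<Gamma> * f t n y))) < 2"
      using eventually_ge_at_top[of 1] by eventually_elim simp
    then obtain n where n: "n \<ge> 1" "- (\<Sum>t\<le>T. S t (\<lambda>y. - (2 * \<Gamma> * f t n y))) < 2"
      by (auto simp: eventually_sequentially)
    obtain \<phi> where \<phi>: "\<phi> \<in> adm (\<lambda>\<omega>. - \<Gamma> * F n \<omega>)"
        "D + (1/2) * (\<Sum>t\<le>T. S t (\<lambda>y. - (2 * \<Gamma> * f t n y))) \<le> U \<phi>"
      using D[OF n(1), of \<Gamma>] by blast
    have "U \<phi> \<le> P - \<Gamma> * L (F n)"
      using sup[OF lin_growth_scale[OF F_B[OF n(1)]] \<phi>(1)] L_scale[OF F_B[OF n(1)], of "- \<Gamma>"] by simp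
    then have "\<Gamma> * L (F n) \<le> \<bar>P - D\<bar> + 1"
      using \<phi>(2) n(2) by linarith
    also have "\<bar>P - D\<bar> + 1 = \<Gamma> * e" using e by (simp add: \<Gamma>_def)
    finally have "L (F n) \<le> e" using \<Gamma> by simp
    then show ?thesis using n by blast
  qed
  have L_cont: "(\<lambda>m. L (g m)) \<longlonglongrightarrow> 0"
    if gB: "\<And>n. g n \<in> B" and dec: "\<And>z n. z \<in> \<Omega> \<Longrightarrow> g (Suc n) z \<le> g n z"
      and lim: "\<And>z. z \<in> \<Omega> \<Longrightarrow> (\<lambda>n. g n z) \<longlonglongrightarrow> 0" for g
  proof -
    have anti: "g n z \<le> g m z" if "m \<le> n" "z \<in> \<Omega>" for m n z
      using lift_Suc_antimono_le[of "\<lambda>n. g n z", OF dec[OF that(2)] that(1)] .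
    have g0: "0 \<le> g m z" if "z \<in> \<Omega>" for m z
      by (rule decseq_ge[OF _ lim[OF that]]) (auto simp: decseq_def intro: anti that)
    obtain C where C: "0 \<le> C" "\<And>z. z \<in> \<Omega> \<Longrightarrow> \<bar>g 0 z\<bar> \<le> C * weight T z"
      using lin_growthE[OF gB] by metis
    show ?thesis
    proof (rule LIMSEQ_I)
      fix e :: real assume e: "e > 0"
      \<comment> \<open>Inside the compact box Dini's theorem gives \<open>e/2\<close>; outside it
        \<open>g m <= g 0 <= C * weight <= C * F n\<close>. The factor 4 leaves room for a strict
        bound, and \<open>C + 1\<close> avoids division by zero.\<close>
      obtain n where n: "n \<ge> 1" "L (F n) \<le> e / (4 * (C + 1))"
        using tight[of "e / (4 * (C + 1))"] e C(1) by auto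
      let ?K = "PiE {0..T} (\<lambda>t. KK t n)"
      have K\<Omega>: "?K \<subseteq> \<Omega>" unfolding Omega_def using KK_compact[OF _ n(1)] by (intro PiE_mono) auto
      obtain N where N: "\<And>m z. N \<le> m \<Longrightarrow> z \<in> ?K \<Longrightarrow> g m z < e / 2"
      proof (rule Dini_decreasing_to_zero[of ?K g "e/2"])
        show "continuous_on ?K (g m)" for m
          using gB[of m] K\<Omega> by (auto simp: lin_growth_def intro: continuous_on_subset)
      qed (use compact_KK[OF n(1)] K\<Omega> dec lim e in auto)
      have "norm (L (g m) - 0) < e" if m: "m \<ge> N" for m
      proof -
        have "L (g m) \<le> L (\<lambda>z. (e/2) * 1 + C * F n z)"
        proof (rule L_mono[OF gB lin_growth_lin[OF lin_growth_const F_B[OF n(1)]]])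
          fix z assume z: "z \<in> \<Omega>"
          show "g m z \<le> (e/2) * 1 + C * F n z"
          proof (cases "z \<in> ?K")
            case True
            then show ?thesis using N[OF m True] C(1) F_nonneg[OF n(1) z] by (simp add: add_increasing2)
          next
            case False
            have "g m z \<le> C * weight T z" using anti[of 0 m z] C(2)[OF z] z by auto
            also have "\<dots> \<le> C * F n z"
              using f_dom[OF n(1), of z] False z C(1) by (intro mult_left_mono) (auto simp: F_def)
            finally show ?thesis using e by simp
          qed
        qed
        also have "\<dots> = e / 2 + C * L (F n)"
          using lin[rule_format, OF lin_growth_const[of 1] F_B[OF n(1)], of "e/2" C] L1 by simp
        also have "\<dots> \<le> e / 2 + C * (e / (4 * (C + 1)))"
          using n(2) C(1) by (intro add_left_mono mult_left_mono) auto
        also have "\<dots> < e"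
        proof -
          have "C * (e / (4 * (C + 1))) \<le> e / 4" using C(1) e by (simp add: field_simps)
          then show ?thesis using e by linarith
        qed
        finally show ?thesis using L_pos[OF gB[of m]] g0 by simp
      qed
      then show "\<exists>N. \<forall>m\<ge>N. norm (L (g m) - 0) < e" by blast
    qed
  qed
  interpret daniell \<Omega> B L
  proof
    show "L (\<lambda>z. a * x z + b * y z) = a * L x + b * L y" if "x \<in> B" "y \<in> B" for x y a b
      using lin that by blast
    show "0 \<le> L x" if "x \<in> B" "\<And>z. z \<in> \<Omega> \<Longrightarrow> 0 \<le> x z" for x by (rule L_pos[OF that])
    show "(\<lambda>n. L (g n)) \<longlonglongrightarrow> 0" if "\<And>n. g n \<in> B" "\<And>z n. z \<in> \<Omega> \<Longrightarrow> g (Suc n) z \<le> g n z"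
      "\<And>z. z \<in> \<Omega> \<Longrightarrow> (\<lambda>n. g n z) \<longlonglongrightarrow> 0" for g by (rule L_cont[OF that])
  qed (rule lin_growth_lin lin_growth_const lin_growth_max lin_growth_cong; assumption?)+
  obtain M where "space M = \<Omega>" "\<And>g. g \<in> B \<Longrightarrow> integrable M g" "\<And>g. g \<in> B \<Longrightarrow> integral\<^sup>L M g = L g"
    using daniell_representation by blast
  then show ?thesis using L1 by (intro exI[of _ M]) auto
qed

text \<open>\<open>M\<close> lives on \<open>\<Omega>\<close> with its own sigma-algebra.
  Coordinates belong to \<open>B\<close> and are therefore measurable, so the identity pushes
  \<open>M\<close> forward to the product sigma-algebra that \<open>Prob1\<close>
  prescribes.\<close>

lemma transfer_to_paths:
  assumes sp: "space M = \<Omega>" and int: "\<And>g. g \<in> B \<Longrightarrow> integrable M g"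
    and one: "(\<integral>x. 1 \<partial>M) = (1::real)"
  defines "Q \<equiv> distr M (path_space T) (\<lambda>x. x)"
  shows "Q \<in> Prob1 T Kc" and "\<And>g. g \<in> B \<Longrightarrow> (LINT x:\<Omega>|Q. g x) = integral\<^sup>L M g"
proof -
  have co: "(\<lambda>x. x t) \<in> measurable M (borel :: (real^'d) measure)" if "t \<le> T" for t
  proof (subst borel_measurable_euclidean_space, intro ballI)
    fix b :: "real^'d" assume "b \<in> Basis"
    then obtain j where b: "b = axis j 1" by (auto simp: Basis_vec_def)
    have "(\<lambda>x. x t $ j) \<in> borel_measurable M" using int[OF lin_growth_coord[OF that]] by auto
    then show "(\<lambda>x. x t \<bullet> b) \<in> borel_measurable M" by (simp add: b inner_axis)
  qed
  have m: "(\<lambda>x. x) \<in> measurable M (path_space T)"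
    unfolding path_space_def
  proof (rule measurable_PiM_single')
    show "(\<lambda>x. x) \<in> space M \<rightarrow> (\<Pi>\<^sub>E i\<in>{0..T}. space borel)"
      unfolding sp Omega_def by (auto simp: PiE_def extensional_def)
  qed (use co in auto)
  have O: "\<Omega> \<in> sets (path_space T)" by (rule sets_Omega[OF K_closed])
  have top: "\<Omega> \<in> sets M" using sets.top[of M] sp by simp
  have fin: "emeasure M (space M) < \<infinity>"
    using int[OF lin_growth_const[of 1]] by (simp add: integrable_iff_bounded)
  then have em: "emeasure M (space M) = 1"
  proof -
    have "measure M (space M) = 1" using one by simp
    then show ?thesis using fin by (simp add: emeasure_eq_ennreal_measure less_top[symmetric])
  qed
  then interpret M: prob_space M by (rule prob_spaceI)
  have "emeasure Q \<Omega> = 1"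
    unfolding Q_def using m O em sp by (subst emeasure_distr) (auto simp: Int_absorb1)
  moreover have "prob_space Q" unfolding Q_def by (rule M.prob_space_distr[OF m])
  moreover have "integrable Q (\<lambda>x. \<bar>x t $ j\<bar>)" if "t \<le> T" for t j
  proof -
    have "(\<lambda>x. x t) \<in> measurable (path_space T) (borel :: (real^'d) measure)"
      unfolding path_space_def using that by (intro measurable_component_singleton) auto
    moreover have "(\<lambda>y::real^'d. \<bar>y $ j\<bar>) \<in> borel_measurable borel"
      by (intro borel_measurable_continuous_onI continuous_intros)
    ultimately have "(\<lambda>x. \<bar>x t $ j\<bar>) \<in> borel_measurable (path_space T)"
      by (rule measurable_compose)
    then show ?thesis unfolding Q_def using int[OF lin_growth_coord[OF that]]
      by (subst integrable_distr_eq[OF m]) auto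
  qed
  ultimately show "Q \<in> Prob1 T Kc" unfolding Prob1_def by (auto simp: Q_def)
  fix g assume g: "g \<in> B"
  have "(LINT x:\<Omega>|Q. g x) = (\<integral>x. indicator \<Omega> x *\<^sub>R g x \<partial>M)"
    unfolding set_lebesgue_integral_def Q_def
    by (rule integral_distr[OF m measurable_lin_growth[OF K_closed g]])
  also have "\<dots> = integral\<^sup>L M g"
    by (rule Bochner_Integration.integral_cong) (auto simp: sp)
  finally show "(LINT x:\<Omega>|Q. g x) = integral\<^sup>L M g" .
qed

text \<open>The nonnegative lower semicontinuous function \<open>c + A * weight\<close> is an
  increasing limit of bounded continuous \<open>h m\<close>. Each \<open>h m - A * weight\<close> is
  a test function in \<open>B\<close> below \<open>c\<close>, and the bound passes to the
  limit.\<close>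

lemma ereal_expect_bound:
  assumes Q: "Q \<in> Prob1 T Kc"
    and le: "\<And>g. g \<in> B \<Longrightarrow> (\<And>x. x \<in> \<Omega> \<Longrightarrow> ereal (g x) \<le> c x) \<Longrightarrow> (LINT x:\<Omega>|Q. g x) \<le> R"
  shows "ereal_expect Q \<Omega> c \<le> ereal R"
proof -
  define w where "w x = A * weight T x" for x :: "nat \<Rightarrow> real^'d"
  have w0: "0 \<le> w x" for x unfolding w_def using A_nonneg weight_ge_1[of T x] by simp
  have wB: "w \<in> B" unfolding w_def by (intro lin_growth_scale lin_growth_weight)
  have cw: "ereal (- w x) \<le> c x" if "x \<in> \<Omega>" for x using c_bound[OF that] by (simp add: w_def)
  have "\<exists>h. (\<forall>m. continuous_on \<Omega> (h m)) \<and>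
    (\<forall>m. \<forall>x\<in>\<Omega>. 0 \<le> h m x \<and> h m x \<le> real m \<and> h m x \<le> h (Suc m) x \<and> ereal (h m x) \<le> c x + ereal (w x)) \<and>
    (\<forall>x\<in>\<Omega>. (SUP m. ereal (h m x)) = c x + ereal (w x))"
  proof (rule lsc_approx_from_below)
    show "openin (top_of_set \<Omega>) {x \<in> \<Omega>. a < c x + ereal (w x)}" for a
      using wB c_not_MInf by (intro lsc_add_continuous c_lsc) (auto simp: lin_growth_def)
    show "0 \<le> c x + ereal (w x)" if "x \<in> \<Omega>" for x
      using cw[OF that] by (cases "c x") auto
  qed
  then obtain h where hc: "\<forall>m. continuous_on \<Omega> (h m)"
    and h': "\<forall>m. \<forall>x\<in>\<Omega>. 0 \<le> h m x \<and> h m x \<le> real m \<and> h m x \<le> h (Suc m) x \<and> ereal (h m x) \<le> c x + ereal (w x)"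
    and hs: "\<forall>x\<in>\<Omega>. (SUP m. ereal (h m x)) = c x + ereal (w x)"
    by (elim exE conjE)
  have h: "0 \<le> h m x \<and> h m x \<le> real m \<and> h m x \<le> h (Suc m) x \<and> ereal (h m x) \<le> c x + ereal (w x)"
    if "x \<in> \<Omega>" for m x using h' that by blast
  have hB: "h m \<in> B" for m
  proof (rule lin_growthI[where C="real m"])
    fix x assume x: "x \<in> \<Omega>"
    have "real m * 1 \<le> real m * weight T x" by (intro mult_left_mono weight_ge_1) simp
    then show "\<bar>h m x\<bar> \<le> real m * weight T x" using h[OF x, of m] by simp
  qed (use hc in simp)
  let ?w = "\<lambda>x. indicator \<Omega> x *\<^sub>R w x"
  let ?h = "\<lambda>m x. indicator \<Omega> x *\<^sub>R h m x"
  show ?thesis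
  proof (rule ereal_expect_le_of_approx[of Q ?w \<Omega> c ?h])
    show "integrable Q ?w" using integrable_lin_growth[OF K_closed Q wB] by (simp add: set_integrable_def)
    show "integrable Q (?h m)" for m using integrable_lin_growth[OF K_closed Q hB[of m]] by (simp add: set_integrable_def)
    show "0 \<le> ?w x" for x using w0 by simp
    show "ereal (- ?w x) \<le> c x" if "x \<in> \<Omega>" for x using cw[OF that] that by simp
    show "0 \<le> ?h m x" for m x using h[of x m] by (cases "x \<in> \<Omega>") auto
    show "?h m x \<le> ?h (Suc m) x" for m x using h[of x m] by (cases "x \<in> \<Omega>") auto
    show "(SUP m. ereal (?h m x)) = (if x \<in> \<Omega> then c x else 0) + ereal (?w x)" for x
      using hs by (cases "x \<in> \<Omega>") (auto simp: zero_ereal_def[symmetric])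
    fix m
    have "(LINT x:\<Omega>|Q. h m x - w x) \<le> R"
    proof (rule le[OF lin_growth_diff[OF hB wB]])
      fix x assume x: "x \<in> \<Omega>"
      show "ereal (h m x - w x) \<le> c x" using h[OF x, of m] by (cases "c x") auto
    qed
    then show "(\<integral>x. ?h m x \<partial>Q) - (\<integral>x. ?w x \<partial>Q) \<le> R"
      using set_integral_diff(2)[OF integrable_lin_growth[OF K_closed Q hB[of m]] integrable_lin_growth[OF K_closed Q wB]]
      by (simp add: set_lebesgue_integral_def)
  qed
qed

text \<open>The hypotheses say that the real number \<open>P\<close> is the supremum of the primal
  problem. The penalties and the cost are maximised one after the other in the inequality
  \<open>key\<close>, first over \<open>\<phi>\<close> with \<open>g\<close> fixed and then over
  \<open>g\<close>.\<close>

lemma strong_duality: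
  assumes bdd: "\<And>\<phi>. \<phi> \<in> adm (\<lambda>\<omega>. 0) \<Longrightarrow> U \<phi> \<le> P"
    and P: "\<And>p. (\<And>\<phi>. \<phi> \<in> adm (\<lambda>\<omega>. 0) \<Longrightarrow> U \<phi> \<le> p) \<Longrightarrow> P \<le> p"
  shows "\<exists>Q\<in>Mart T Kc. dual_value Q \<le> ereal P"
proof -
  obtain L where lin: "\<forall>x\<in>B. \<forall>y\<in>B. \<forall>a b. L (\<lambda>z. a * x z + b * y z) = a * L x + b * L y"
    and sup: "\<And>x \<phi>. x \<in> B \<Longrightarrow> \<phi> \<in> adm x \<Longrightarrow> U \<phi> \<le> P + L x"
    using ex_supergradient[OF bdd P] by blast
  obtain M where M: "space M = \<Omega>" "\<And>g. g \<in> B \<Longrightarrow> integrable M g" "\<And>g. g \<in> B \<Longrightarrow> integral\<^sup>L M g = L g"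
      "L (\<lambda>z. 1) = 1"
    using supergradient_represented[OF bdd P lin sup] by blast
  define Q where "Q = distr M (path_space T) (\<lambda>x. x)"
  have one: "(\<integral>x. 1 \<partial>M) = (1::real)" using M(3)[OF lin_growth_const[of 1]] M(4) by simp
  have Q1: "Q \<in> Prob1 T Kc" and QL: "\<And>g. g \<in> B \<Longrightarrow> (LINT x:\<Omega>|Q. g x) = L g"
    using transfer_to_paths[OF M(1,2) one] M(3) unfolding Q_def by auto
  have key: "U \<phi> \<le> P + (\<Sum>t\<le>T. LINT x:\<Omega>|Q. \<phi> t (x t)) + L (Idelta T \<Delta>) - L g"
    if \<phi>: "\<And>t. t \<le> T \<Longrightarrow> \<phi> t \<in> E t" and \<Delta>: "\<Delta> \<in> Hstrat T Kc"
      and g: "g \<in> B" "\<And>x. x \<in> \<Omega> \<Longrightarrow> ereal (g x) \<le> c x" for \<phi> \<Delta> g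
  proof -
    let ?s = "\<lambda>x. \<Sum>t\<le>T. \<phi> t (x t)"
    \<comment> \<open>With this perturbation \<open>\<phi>\<close> and \<open>\<Delta>\<close> are
      feasible exactly because \<open>g <= c\<close>. The unit coefficients match the form in which
      linearity of \<open>L\<close> is available.\<close>
    let ?x = "\<lambda>x. 1 * (1 * ?s x + 1 * Idelta T \<Delta> x) + (-1) * g x"
    have sB: "?s \<in> B" by (rule E_sum_B[OF \<phi>])
    have IB: "Idelta T \<Delta> \<in> B" by (rule lin_growth_Idelta[OF \<Delta>])
    have "ereal (?s \<omega> + Idelta T \<Delta> \<omega>) \<le> c \<omega> + ereal (?x \<omega>)" if "\<omega> \<in> \<Omega>" for \<omega>
      using g(2)[OF that] by (cases "c \<omega>") auto
    then have "\<phi> \<in> adm ?x" unfolding adm_def using \<phi> \<Delta> by blast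
    then have "U \<phi> \<le> P + L ?x"
      by (intro sup lin_growth_lin sB IB g)
    also have "L ?x = L ?s + L (Idelta T \<Delta>) - L g"
      using lin[rule_format, OF lin_growth_lin[OF sB IB, of 1 1] g(1), of 1 "-1"]
        lin[rule_format, OF sB IB, of 1 1] by simp
    also have "L ?s = (\<Sum>t\<le>T. LINT x:\<Omega>|Q. \<phi> t (x t))"
      using QL[OF sB] set_integral_sum_paths[OF Q1 \<phi>] by simp
    finally show ?thesis by simp
  qed
  have wB: "(\<lambda>x. - A * weight T x) \<in> B" by (intro lin_growth_scale lin_growth_weight)
  have I0: "L (Idelta T \<Delta>) = 0" if \<Delta>: "\<Delta> \<in> Hstrat T Kc" for \<Delta>
  proof -
    \<comment> \<open>For \<open>\<phi> = 0\<close> and \<open>g = - A * weight\<close>, scaling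
      \<open>\<Delta>\<close> by \<open>a\<close> yields an affine function of \<open>a\<close> that
      is nonnegative on the whole line, so its slope vanishes; a nonzero slope would allow the value
      -1.\<close>
    define k where "k = P - L (\<lambda>x. - A * weight T x)"
    have *: "0 \<le> k + a * L (Idelta T \<Delta>)" for a
    proof -
      have aH: "(\<lambda>t y. a *\<^sub>R \<Delta> t y + 0 *\<^sub>R \<Delta> t y) \<in> Hstrat T Kc" by (rule Hstrat_lin[OF \<Delta> \<Delta>])
      have aI: "Idelta T (\<lambda>t y. a *\<^sub>R \<Delta> t y + 0 *\<^sub>R \<Delta> t y) = (\<lambda>x. a * Idelta T \<Delta> x + 0 * Idelta T \<Delta> x)"
        by (rule ext, rule Idelta_lin)
      have LI: "L (\<lambda>x. a * Idelta T \<Delta> x + 0 * Idelta T \<Delta> x) = a * L (Idelta T \<Delta>)"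
        using lin[rule_format, OF lin_growth_Idelta[OF \<Delta>] lin_growth_Idelta[OF \<Delta>], of a 0] by simp
      have "U (\<lambda>t y. 0) \<le> P + (\<Sum>t\<le>T. LINT x:\<Omega>|Q. 0)
          + L (Idelta T (\<lambda>t y. a *\<^sub>R \<Delta> t y + 0 *\<^sub>R \<Delta> t y)) - L (\<lambda>x. - A * weight T x)"
        by (rule key[OF E_zero aH wB c_bound])
      then show ?thesis unfolding aI LI by (simp add: U_def S_zero k_def set_lebesgue_integral_def)
    qed
    show ?thesis
    proof (rule ccontr)
      assume "L (Idelta T \<Delta>) \<noteq> 0"
      then show False using *[of "- (k + 1) / L (Idelta T \<Delta>)"] by simp
    qed
  qed
  have QM: "Q \<in> Mart T Kc"
    unfolding Mart_def using Q1 I0 QL[OF lin_growth_Idelta] by auto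
  let ?D = "\<Sum>t\<le>T. Dpen (Kset Kc t) (E t) (S t) (marg Q t)"
  have D_le: "?D \<le> ereal (P - L g)" if g: "g \<in> B" "\<And>x. x \<in> \<Omega> \<Longrightarrow> ereal (g x) \<le> c x" for g
  proof -
    have "(\<Sum>t\<in>{..T}. SUP \<phi>\<in>E t. ereal (S t \<phi> - (LINT x:\<Omega>|Q. \<phi> (x t)))) \<le> ereal (P - L g)"
    proof (rule sum_SUP_le)
      show "E t \<noteq> {}" if "t \<in> {..T}" for t using E_zero[of t] that by auto
      fix \<phi> assume "\<And>t. t \<in> {..T} \<Longrightarrow> \<phi> t \<in> E t"
      then have "U \<phi> \<le> P + (\<Sum>t\<le>T. LINT x:\<Omega>|Q. \<phi> t (x t)) + L (Idelta T (\<lambda>t y. 0)) - L g"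
        by (intro key Hstrat_zero g) auto
      then show "(\<Sum>t\<in>{..T}. S t (\<phi> t) - (LINT x:\<Omega>|Q. \<phi> t (x t))) \<le> P - L g"
        using I0[OF Hstrat_zero] by (simp add: U_def sum_subtractf)
    qed simp
    also have "(\<Sum>t\<in>{..T}. SUP \<phi>\<in>E t. ereal (S t \<phi> - (LINT x:\<Omega>|Q. \<phi> (x t)))) = ?D"
      unfolding Dpen_def
    proof (intro sum.cong SUP_cong refl)
      fix t \<phi> assume "t \<in> {..T}" "\<phi> \<in> E t"
      then have "(LINT y:Kset Kc t|marg Q t. \<phi> y) = (LINT x:\<Omega>|Q. \<phi> (x t))"
        using E_sub[of t] by (intro integral_marg[OF K_closed Q1]) auto
      then show "ereal (S t \<phi> - (LINT x:\<Omega>|Q. \<phi> (x t))) = ereal (S t \<phi> - (LINT y:Kset Kc t|marg Q t. \<phi> y))" by simp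
    qed
    finally show ?thesis .
  qed
  \<comment> \<open>The choice \<open>\<phi> = 0\<close> bounds the penalties below and the single
    test function \<open>- A * weight\<close> bounds them above. Being finite, they can be moved to
    the other side as a bound on each \<open>L g\<close>.\<close>
  have "0 \<le> ?D" using Dpen_nonneg[OF Q1] by (intro sum_nonneg) auto
  moreover have "?D \<le> ereal (P - L (\<lambda>x. - A * weight T x))" by (rule D_le[OF wB c_bound])
  ultimately obtain D where D: "?D = ereal D" by (cases ?D) auto
  have "ereal_expect Q \<Omega> c \<le> ereal (P - D)"
    using D_le D QL by (intro ereal_expect_bound[OF Q1]) (fastforce simp: algebra_simps)
  then have "dual_value Q \<le> ereal (P - D) + ereal D"
    unfolding dual_value_def D by (rule add_right_mono)
  then show ?thesis using QM by auto
qed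

end

theorem theorem3p4:
  fixes T :: nat
    and Kc :: "nat \<Rightarrow> 'd::finite \<Rightarrow> real set"
    and E :: "nat \<Rightarrow> (real^'d \<Rightarrow> real) set"
    and S :: "nat \<Rightarrow> (real^'d \<Rightarrow> real) \<Rightarrow> real"
    and KK :: "nat \<Rightarrow> nat \<Rightarrow> (real^'d) set"
    and f :: "nat \<Rightarrow> nat \<Rightarrow> real^'d \<Rightarrow> real"
    and c :: "(nat \<Rightarrow> real^'d) \<Rightarrow> ereal"
    and A :: real
  assumes T_ge: "T \<ge> 1"
    and K_closed: "\<And>t j. t \<le> T \<Longrightarrow> closed (Kc t j)"
    \<comment> \<open>E_t is a vector subspace of C_t, stable under adding constants, containing the coordinate maps\<close>
    and E_sub: "\<And>t. t \<le> T \<Longrightarrow> E t \<subseteq> Ct Kc t"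
    and E_zero: "\<And>t. t \<le> T \<Longrightarrow> (\<lambda>y. 0) \<in> E t"
    and E_add: "\<And>t \<phi> \<psi>. t \<le> T \<Longrightarrow> \<phi> \<in> E t \<Longrightarrow> \<psi> \<in> E t \<Longrightarrow> (\<lambda>y. \<phi> y + \<psi> y) \<in> E t"
    and E_scale: "\<And>t \<phi> a. t \<le> T \<Longrightarrow> \<phi> \<in> E t \<Longrightarrow> (\<lambda>y. a * \<phi> y) \<in> E t"
    and E_const: "\<And>t \<phi> k. t \<le> T \<Longrightarrow> \<phi> \<in> E t \<Longrightarrow> (\<lambda>y. \<phi> y + k) \<in> E t"
    and E_coord: "\<And>t j. t \<le> T \<Longrightarrow> (\<lambda>y. y $ j) \<in> E t"
    \<comment> \<open>S_t is a function on E_t viewed as functions on K_t (well defined on restrictions)\<close>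
    and S_welldef: "\<And>t \<phi> \<psi>. t \<le> T \<Longrightarrow> \<phi> \<in> E t \<Longrightarrow> \<psi> \<in> E t \<Longrightarrow>
         (\<forall>y\<in>Kset Kc t. \<phi> y = \<psi> y) \<Longrightarrow> S t \<phi> = S t \<psi>"
    and S_concave: "\<And>t \<phi> \<psi> l. t \<le> T \<Longrightarrow> \<phi> \<in> E t \<Longrightarrow> \<psi> \<in> E t \<Longrightarrow> 0 \<le> l \<Longrightarrow> l \<le> 1 \<Longrightarrow>
         S t (\<lambda>y. l * \<phi> y + (1 - l) * \<psi> y) \<ge> l * S t \<phi> + (1 - l) * S t \<psi>"
    and S_cash: "\<And>t \<phi> k. t \<le> T \<Longrightarrow> \<phi> \<in> E t \<Longrightarrow> S t (\<lambda>y. \<phi> y + k) = S t \<phi> + k"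
    and S_zero: "\<And>t. t \<le> T \<Longrightarrow> S t (\<lambda>y. 0) = 0"
    \<comment> \<open>tightness-type condition with compacts KK t n and functions f t n\<close>
    and KK_compact: "\<And>t n. t \<le> T \<Longrightarrow> n \<ge> 1 \<Longrightarrow> compact (KK t n) \<and> KK t n \<subseteq> Kset Kc t"
    and f_in: "\<And>t n. t \<le> T \<Longrightarrow> n \<ge> 1 \<Longrightarrow> f t n \<in> E t \<and> (\<forall>y\<in>Kset Kc t. 0 \<le> f t n y)"
    and f_dom: "\<And>n x. n \<ge> 1 \<Longrightarrow> x \<in> Omega T Kc - PiE {0..T} (\<lambda>t. KK t n) \<Longrightarrow>
         1 + (\<Sum>t\<le>T. \<Sum>j\<in>UNIV. \<bar>x t $ j\<bar>) \<le> (\<Sum>t\<le>T. f t n (x t))"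
    and V_lim: "\<And>\<Gamma>. \<Gamma> > 0 \<Longrightarrow>
         (\<lambda>n. - (\<Sum>t\<le>T. S t (\<lambda>y. - (\<Gamma> * f t n y)))) \<longlonglongrightarrow> 0"
    \<comment> \<open>the cost function\<close>
    and c_lsc: "\<And>a. openin (top_of_set (Omega T Kc)) {x \<in> Omega T Kc. a < c x}"
    and A_nonneg: "A \<ge> 0"
    and c_bound: "\<And>x. x \<in> Omega T Kc \<Longrightarrow>
         c x \<ge> ereal (- A * (1 + (\<Sum>t\<le>T. \<Sum>j\<in>UNIV. \<bar>x t $ j\<bar>)))"
  shows "(SUP \<phi> \<in> {\<phi>. (\<forall>t\<le>T. \<phi> t \<in> E t) \<and>
              (\<exists>\<Delta>\<in>Hstrat T Kc. \<forall>x\<in>Omega T Kc.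
                 ereal ((\<Sum>t\<le>T. \<phi> t (x t)) + Idelta T \<Delta> x) \<le> c x)}.
            ereal (\<Sum>t\<le>T. S t (\<phi> t)))
       = (INF Q \<in> Mart T Kc. ereal_expect Q (Omega T Kc) c
            + (\<Sum>t\<le>T. Dpen (Kset Kc t) (E t) (S t) (marg Q t)))
     \<and> ((INF Q \<in> Mart T Kc. ereal_expect Q (Omega T Kc) c
            + (\<Sum>t\<le>T. Dpen (Kset Kc t) (E t) (S t) (marg Q t))) < \<infinity> \<longrightarrow>
        (\<exists>Q0 \<in> Mart T Kc. ereal_expect Q0 (Omega T Kc) c
            + (\<Sum>t\<le>T. Dpen (Kset Kc t) (E t) (S t) (marg Q0 t))
          = (INF Q \<in> Mart T Kc. ereal_expect Q (Omega T Kc) c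
            + (\<Sum>t\<le>T. Dpen (Kset Kc t) (E t) (S t) (marg Q t)))))"
proof -
  interpret mot T Kc E S KK f c A
  proof
    show "\<forall>t\<le>T. \<forall>j. closed (Kc t j)" using K_closed by blast
    show "weight T x \<le> (\<Sum>t\<le>T. f t n (x t))"
      if "n \<ge> 1" "x \<in> Omega T Kc - PiE {0..T} (\<lambda>t. KK t n)" for n x
      unfolding weight_def by (rule f_dom[OF that])
    show "ereal (- A * weight T x) \<le> c x" if "x \<in> Omega T Kc" for x
      unfolding weight_def by (rule c_bound[OF that])
  qed (fact E_sub E_zero E_add E_scale E_const S_concave S_cash S_zero KK_compact f_in V_lim c_lsc A_nonneg)+
  let ?X = "{\<phi>. (\<forall>t\<le>T. \<phi> t \<in> E t) \<and> (\<exists>\<Delta>\<in>Hstrat T Kc. \<forall>x\<in>Omega T Kc.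
      ereal ((\<Sum>t\<le>T. \<phi> t (x t)) + Idelta T \<Delta> x) \<le> c x)}"
  let ?P = "SUP \<phi> \<in> ?X. ereal (\<Sum>t\<le>T. S t (\<phi> t))"
  let ?D = "INF Q \<in> Mart T Kc. dual_value Q"
  have X: "?X = adm (\<lambda>\<omega>. 0)" by (simp add: adm_def zero_ereal_def[symmetric])
  have P: "?P = (SUP \<phi> \<in> adm (\<lambda>\<omega>. 0). ereal (U \<phi>))" unfolding X U_def ..
  have weak: "?P \<le> ?D"
    unfolding P by (intro SUP_least INF_greatest weak_duality)
  have strong: "\<exists>Q\<in>Mart T Kc. dual_value Q \<le> ?P" if fin: "?P < \<infinity>"
  proof -
    \<comment> \<open>A feasible point excludes the value \<open>- \<infinity>\<close>, so the
      primal value is a real number.\<close>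
    obtain \<phi>0 where "\<phi>0 \<in> adm (\<lambda>\<omega>. 0)" using adm_nonempty[OF lin_growth_const[of 0]] by blast
    then have "ereal (U \<phi>0) \<le> ?P" unfolding P by (rule SUP_upper)
    then obtain p where p: "?P = ereal p" using fin by (cases ?P) auto
    have "\<exists>Q\<in>Mart T Kc. dual_value Q \<le> ereal p"
    proof (rule strong_duality)
      fix \<phi> assume "\<phi> \<in> adm (\<lambda>\<omega>. 0)"
      then have "ereal (U \<phi>) \<le> ?P" unfolding P by (rule SUP_upper)
      then show "U \<phi> \<le> p" unfolding p by simp
    next
      fix p' assume "\<And>\<phi>. \<phi> \<in> adm (\<lambda>\<omega>. 0) \<Longrightarrow> U \<phi> \<le> p'"
      then have "?P \<le> ereal p'" unfolding P by (intro SUP_least) auto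
      then show "p \<le> p'" unfolding p by simp
    qed
    then show ?thesis unfolding p .
  qed
  have eq: "?P = ?D"
  proof (cases "?P < \<infinity>")
    case True
    then obtain Q where "Q \<in> Mart T Kc" "dual_value Q \<le> ?P" using strong by blast
    then have "?D \<le> ?P" by (rule INF_lower2)
    with weak show ?thesis by (rule antisym)
  next
    case False
    then have "?P = \<infinity>" by simp
    with weak show ?thesis by simp
  qed
  \<comment> \<open>By the equality of values a finite infimum means a finite supremum, and the
    measure obtained in that case is a minimiser.\<close>
  have att: "\<exists>Q0\<in>Mart T Kc. dual_value Q0 = ?D" if fin: "?D < \<infinity>"
  proof -
    obtain Q where Q: "Q \<in> Mart T Kc" "dual_value Q \<le> ?P" using strong[unfolded eq, OF fin] unfolding eq by blast
    have "?D \<le> dual_value Q" by (rule INF_lower[OF Q(1)])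
    with Q(2)[unfolded eq] have "dual_value Q = ?D" by (rule antisym)
    then show ?thesis using Q(1) by blast
  qed
  show ?thesis
    using eq att unfolding dual_value_def by (intro conjI impI)
qed

end
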